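(* Let $\Omega$ be a bounded convex domain in $\mathbb R^n$ with smooth boundary and, for $j>0$, let $\sigma_j(x)=e^{-j|x|^2}$. Then, for all $j>0$, $$\lambda_2(L_{\sigma_j})\ge 2j.$$
   Context: For a positive density $\sigma=e^{-f}$ on $\overline\Omega$, $L_\sigma u=\Delta u+\nabla f\cdot\nabla u$ with $\Delta=-\sum_i\partial_i^2$, considered on $\Omega$ with Neumann boundary conditions; it is self-adjoint on $L^2(\Omega,\sigma\,dx)$ with eigenvalues $0=\lambda_1(L_\sigma)<\lambda_2(L_\sigma)\le\cdots$. *)

theory Defs
  imports "HOL-Analysis.Analysis"
begin

definition partial :: "'a::euclidean_space \<Rightarrow> ('a \<Rightarrow> real) \<Rightarrow> 'a \<Rightarrow> real"
  where "partial b u x = frechet_derivative u (at x) b"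

definition grad :: "('a::euclidean_space \<Rightarrow> real) \<Rightarrow> 'a \<Rightarrow> 'a"
  where "grad u x = (\<Sum>b\<in>Basis. partial b u x *\<^sub>R b)"

definition smooth :: "('a::euclidean_space \<Rightarrow> real) \<Rightarrow> bool"
  where "smooth u \<longleftrightarrow>
    (\<forall>bs x. set bs \<subseteq> Basis \<longrightarrow> foldr partial bs u differentiable (at x))"

(* Near the boundary point p, the set is the sublevel set {rho < 0} of a function with
   nonvanishing gradient at p; asking rho to be smooth on the whole space is no restriction,
   since U may be shrunk and rho cut off. *)
definition local_defining_function :: "'a::euclidean_space set \<Rightarrow> 'a \<Rightarrow> ('a \<Rightarrow> real) \<Rightarrow> bool"
  where "local_defining_function \<Omega> p \<rho> \<longleftrightarrow>
    smooth \<rho> \<and> grad \<rho> p \<noteq> 0 \<and> (\<exists>U. open U \<and> p \<in> U \<and> \<Omega> \<inter> U = {x \<in> U. \<rho> x < 0})"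

definition smooth_boundary :: "'a::euclidean_space set \<Rightarrow> bool"
  where "smooth_boundary \<Omega> \<longleftrightarrow> (\<forall>p\<in>frontier \<Omega>. \<exists>\<rho>. local_defining_function \<Omega> p \<rho>)"

definition outward_unit_normal :: "'a::euclidean_space set \<Rightarrow> 'a \<Rightarrow> 'a \<Rightarrow> bool"
  where "outward_unit_normal \<Omega> p \<nu> \<longleftrightarrow>
    (\<exists>\<rho>. local_defining_function \<Omega> p \<rho> \<and> \<nu> = grad \<rho> p /\<^sub>R norm (grad \<rho> p))"

definition neumann_condition :: "'a::euclidean_space set \<Rightarrow> ('a \<Rightarrow> real) \<Rightarrow> bool"
  where "neumann_condition \<Omega> u \<longleftrightarrow>
    (\<forall>p\<in>frontier \<Omega>. \<forall>\<nu>. outward_unit_normal \<Omega> p \<nu> \<longrightarrow> grad u p \<bullet> \<nu> = 0)"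

definition laplacian :: "('a::euclidean_space \<Rightarrow> real) \<Rightarrow> 'a \<Rightarrow> real"
  where "laplacian u x = - (\<Sum>b\<in>Basis. partial b (partial b u) x)"

(* sigma = e^{-f}, i.e. f = - ln sigma *)
definition weighted_laplacian ::
    "('a::euclidean_space \<Rightarrow> real) \<Rightarrow> ('a \<Rightarrow> real) \<Rightarrow> 'a \<Rightarrow> real"
  where "weighted_laplacian \<sigma> u x =
    laplacian u x + grad (\<lambda>y. - ln (\<sigma> y)) x \<bullet> grad u x"

definition weighted_measure :: "'a::euclidean_space set \<Rightarrow> ('a \<Rightarrow> real) \<Rightarrow> 'a measure"
  where "weighted_measure \<Omega> \<sigma> = density lborel (\<lambda>x. ennreal (indicator \<Omega> x * \<sigma> x))"

definition L2 :: "'a measure \<Rightarrow> ('a \<Rightarrow> real) set"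
  where "L2 M = {u \<in> borel_measurable M. integrable M (\<lambda>x. (u x)\<^sup>2)}"

definition L2_tendsto :: "'a measure \<Rightarrow> (nat \<Rightarrow> 'a \<Rightarrow> real) \<Rightarrow> ('a \<Rightarrow> real) \<Rightarrow> bool"
  where "L2_tendsto M v u \<longleftrightarrow> (\<forall>m. v m \<in> L2 M) \<and> u \<in> L2 M \<and>
    (\<lambda>m. \<integral>x. (v m x - u x)\<^sup>2 \<partial>M) \<longlonglongrightarrow> 0"

(* Graph of the self-adjoint Neumann realization of the weighted Laplacian in
   L^2(Omega, sigma dx): "u lies in the domain and is mapped to g" (both up to null sets).
   It is the closure of the differential operator acting on functions that are smooth up to
   the boundary and satisfy the Neumann condition; that operator is essentially self-adjoint
   when Omega is bounded with smooth boundary and sigma is smooth and positive near the closure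
   of Omega. *)
definition neumann_operator ::
    "'a::euclidean_space set \<Rightarrow> ('a \<Rightarrow> real) \<Rightarrow> ('a \<Rightarrow> real) \<Rightarrow> ('a \<Rightarrow> real) \<Rightarrow> bool"
  where "neumann_operator \<Omega> \<sigma> u g \<longleftrightarrow>
    (\<exists>v. (\<forall>m. smooth (v m) \<and> neumann_condition \<Omega> (v m)) \<and>
      L2_tendsto (weighted_measure \<Omega> \<sigma>) v u \<and>
      L2_tendsto (weighted_measure \<Omega> \<sigma>) (\<lambda>m. weighted_laplacian \<sigma> (v m)) g)"

definition neumann_eigenfunction ::
    "'a::euclidean_space set \<Rightarrow> ('a \<Rightarrow> real) \<Rightarrow> real \<Rightarrow> ('a \<Rightarrow> real) \<Rightarrow> bool"
  where "neumann_eigenfunction \<Omega> \<sigma> \<mu> u \<longleftrightarrow>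
    neumann_operator \<Omega> \<sigma> u (\<lambda>x. \<mu> * u x) \<and> \<not> (AE x in weighted_measure \<Omega> \<sigma>. u x = 0)"

definition L2_independent :: "'a measure \<Rightarrow> nat \<Rightarrow> (nat \<Rightarrow> 'a \<Rightarrow> real) \<Rightarrow> bool"
  where "L2_independent M k u \<longleftrightarrow>
    (\<forall>c. (AE x in M. (\<Sum>i<k. c i * u i x) = 0) \<longrightarrow> (\<forall>i<k. c i = 0))"

(* The k-th smallest eigenvalue (k = 1, 2, ...), counted with multiplicity: the least t such
   that the eigenspaces belonging to eigenvalues \<le> t have total dimension at least k.
   The value is infinity if there are fewer than k eigenvalues. *)
definition neumann_eigenvalue :: "'a::euclidean_space set \<Rightarrow> ('a \<Rightarrow> real) \<Rightarrow> nat \<Rightarrow> ereal"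
  where "neumann_eigenvalue \<Omega> \<sigma> k = Inf {ereal t | t.
    \<exists>\<mu> u. (\<forall>i<k. neumann_eigenfunction \<Omega> \<sigma> (\<mu> i) (u i) \<and> \<mu> i \<le> t) \<and>
      L2_independent (weighted_measure \<Omega> \<sigma>) k u}"

end

(* A vector field X that does not point out of a bounded convex domain D moves D under
   x |-> x + h X(x) into a dilation of D by a factor 1 + o(h); comparing volumes through the change of
   variables formula yields that the integral of div X over D is at most 0. For a smooth v satisfying
   the Neumann condition, the fields +-sigma v grad v give <v, Lv> = |grad v|^2, and
   sigma (D(grad v) grad v + (Lv) grad v), which does not point outwards by convexity, gives the
   Bochner inequality |Lv|^2 >= 2j |grad v|^2 (norms in L^2(sigma)). Both pass to the closure, so an
   eigenvalue is either >= 2j or 0, and in the latter case a limit of functions whose gradients tend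
   to 0 is almost everywhere constant. *)
theory Submission
  imports Defs
begin

text \<open>The constant 2j is the Hessian of f = j|x|^2, namely 2j times the identity; it appears
  when the drift coefficient of L is differentiated. The boundary enters only through the sign of X
  . grad rho, without surface measure or traces. Hence each integral relation starts as an
  inequality: equality in the energy formula needs both signs of a field tangent to the boundary,
  and in the Bochner formula the discarded terms (squared Hessian, boundary curvature) have the
  right sign. The obstacle is regularity. An eigenfunction is given only as an L2 limit of smooth
  v_m with L v_m converging too; its smoothness is never established. With N = |u|^2 one gets |grad
  v_m|^2 -> mu N and |L v_m|^2 -> mu^2 N, hence 2j mu <= mu^2. For mu = 0 the limit u is merely
  measurable, so constancy cannot be read off a derivative. Instead u(x) is compared with its value
  at the midpoint of x and p; the comparison survives the limit, and since the midpoint is symmetric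
  in x and p, Fubini yields u(x) = u(p) for almost all pairs.\<close>

section \<open>Iterated partial derivatives\<close>

lemma smoothD: "smooth u \<Longrightarrow> u differentiable (at x)"
  unfolding smooth_def by (drule spec[of _ "[]"]) simp

lemma smooth_partial:
  assumes "smooth u" "b \<in> Basis" shows "smooth (partial b u)"
  unfolding smooth_def
proof (intro allI impI)
  fix bs :: "'a list" and x assume "set bs \<subseteq> Basis"
  with assms have "foldr partial (bs @ [b]) u differentiable (at x)"
    unfolding smooth_def by (metis Un_insert_right append_Nil2 empty_set insert_subset list.simps(15) set_append)
  then show "foldr partial bs (partial b u) differentiable (at x)" by simp
qed

lemma smooth_continuous: "smooth u \<Longrightarrow> continuous_on S u"
  by (meson continuous_at_imp_continuous_on differentiable_imp_continuous_within smoothD)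

lemma smoothI_step:
  assumes "\<And>x. u differentiable (at x)" "\<And>b. b \<in> Basis \<Longrightarrow> smooth (partial b u)"
  shows "smooth u"
  unfolding smooth_def
proof (intro allI impI)
  fix bs :: "'a list" and x assume bs: "set bs \<subseteq> Basis"
  show "foldr partial bs u differentiable (at x)"
  proof (cases bs rule: rev_cases)
    case Nil then show ?thesis using assms by simp
  next
    case (snoc cs b)
    then have "b \<in> Basis" "set cs \<subseteq> Basis" using bs by auto
    then show ?thesis using assms(2)[of b] snoc unfolding smooth_def by simp
  qed
qed

lemma partial_eq: "(u has_derivative D) (at x) \<Longrightarrow> partial b u x = D b"
  unfolding partial_def by (metis frechet_derivative_at)

lemma has_derivative_partial:
  assumes "u differentiable (at x)"
  shows "(u has_derivative (\<lambda>h. \<Sum>b\<in>Basis. (h \<bullet> b) * partial b u x)) (at x)"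
proof -
  let ?D = "frechet_derivative u (at x)"
  have D: "(u has_derivative ?D) (at x)" using assms frechet_derivative_works by blast
  then interpret linear ?D by (rule has_derivative_linear)
  have "?D h = (\<Sum>b\<in>Basis. (h \<bullet> b) * partial b u x)" for h
    by (subst euclidean_representation[of h, symmetric])
       (simp only: sum scale partial_def real_scaleR_def)
  then show ?thesis using D by presburger
qed

lemma grad_inner: "grad u x \<bullet> h = (\<Sum>b\<in>Basis. (h \<bullet> b) * partial b u x)"
  unfolding grad_def inner_commute[of _ h] inner_sum_right by (simp add: mult.commute)

lemma grad_inner_Basis: "b \<in> Basis \<Longrightarrow> grad u x \<bullet> b = partial b u x"
  unfolding grad_def by simp

lemma has_derivative_grad:
  "u differentiable (at x) \<Longrightarrow> (u has_derivative (\<lambda>h. grad u x \<bullet> h)) (at x)"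
  using has_derivative_partial[of u x] by (simp add: grad_inner)

lemma norm_grad_square: "(norm (grad u x))\<^sup>2 = (\<Sum>b\<in>Basis. (partial b u x)\<^sup>2)"
  unfolding power2_norm_eq_inner grad_inner[of u x "grad u x"]
  by (simp add: grad_inner_Basis power2_eq_square)

lemma partial_add:
  assumes "u differentiable (at x)" "v differentiable (at x)"
  shows "partial b (\<lambda>x. u x + v x) x = partial b u x + partial b v x"
  by (rule partial_eq[THEN trans])
     (auto intro!: has_derivative_add assms[THEN frechet_derivative_works[THEN iffD1]] simp: partial_def)

lemma partial_sum:
  assumes "\<And>i. i \<in> I \<Longrightarrow> u i differentiable (at x)"
  shows "partial b (\<lambda>x. \<Sum>i\<in>I. u i x) x = (\<Sum>i\<in>I. partial b (u i) x)"
  by (rule partial_eq[THEN trans])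
     (auto intro!: has_derivative_sum assms[THEN frechet_derivative_works[THEN iffD1]] simp: partial_def)

lemma partial_mult:
  assumes "u differentiable (at x)" "v differentiable (at x)"
  shows "partial b (\<lambda>x. u x * v x) x = partial b u x * v x + u x * partial b v x"
  by (rule partial_eq[THEN trans])
     (rule has_derivative_mult assms[THEN frechet_derivative_works[THEN iffD1]] | simp add: partial_def)+

lemma partial_const: "partial b (\<lambda>x. c) x = 0"
  by (rule partial_eq[THEN trans]) auto

lemma partial_inner: "partial b (\<lambda>x. x \<bullet> c) x = b \<bullet> c"
  by (rule partial_eq[THEN trans]) (auto intro!: derivative_eq_intros)

lemma smooth_const: "smooth (\<lambda>x. c)"
proof -
  have "foldr partial bs (\<lambda>x::'a. c) = (\<lambda>x. if bs = [] then c else 0)" for bs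
  proof (induction bs)
    case (Cons b bs)
    show ?case unfolding foldr_Cons o_apply Cons by (auto simp: partial_const fun_eq_iff)
  qed simp
  then show ?thesis unfolding smooth_def by simp
qed

lemma smooth_inner: "smooth (\<lambda>x. x \<bullet> c)"
  by (rule smoothI_step) (auto simp: partial_inner[abs_def] smooth_const)

text \<open>The truncation of \<open>smooth\<close> at order n. Closure under products is proved by
  induction on n, since a derivative of a product is a sum of products of functions of the previous
  class; \<open>smooth\<close> itself offers no order to induct on.\<close>

definition C_diff :: "nat \<Rightarrow> ('a::euclidean_space \<Rightarrow> real) \<Rightarrow> bool"
  where "C_diff n u \<longleftrightarrow>
    (\<forall>bs x. length bs \<le> n \<and> set bs \<subseteq> Basis \<longrightarrow> foldr partial bs u differentiable (at x))"

lemma smooth_iff_C_diff: "smooth u \<longleftrightarrow> (\<forall>n. C_diff n u)"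
  unfolding smooth_def C_diff_def by blast

lemma C_diff_0: "C_diff 0 u \<longleftrightarrow> (\<forall>x. u differentiable (at x))"
  unfolding C_diff_def by auto

lemma C_diff_Suc:
  "C_diff (Suc n) u \<longleftrightarrow> (\<forall>x. u differentiable (at x)) \<and> (\<forall>b\<in>Basis. C_diff n (partial b u))"
  (is "?L \<longleftrightarrow> ?R")
proof
  assume L: ?L
  have "foldr partial bs (partial b u) differentiable (at x)"
    if "b \<in> Basis" "length bs \<le> n" "set bs \<subseteq> Basis" for b bs x
    using L[unfolded C_diff_def, rule_format, of "bs @ [b]" x] that by simp
  moreover have "u differentiable (at x)" for x
    using L[unfolded C_diff_def, rule_format, of "[]" x] by simp
  ultimately show ?R unfolding C_diff_def by blast
next
  assume R: ?R
  show ?L unfolding C_diff_def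
  proof (intro allI impI)
    fix bs :: "'a list" and x assume bs: "length bs \<le> Suc n \<and> set bs \<subseteq> Basis"
    show "foldr partial bs u differentiable (at x)"
    proof (cases bs rule: rev_cases)
      case Nil then show ?thesis using R by simp
    next
      case (snoc cs b)
      then show ?thesis using bs R unfolding C_diff_def by simp
    qed
  qed
qed

lemma C_diff_mono: "C_diff (Suc n) u \<Longrightarrow> C_diff n u"
  unfolding C_diff_def by (meson le_SucI)

lemma C_diff_differentiable: "C_diff n u \<Longrightarrow> u differentiable (at x)"
  by (cases n) (auto simp: C_diff_0 C_diff_Suc)

lemma C_diff_add:
  "C_diff n u \<Longrightarrow> C_diff n v \<Longrightarrow> C_diff n (\<lambda>x. u x + v x)"
proof (induction n arbitrary: u v)
  case 0 then show ?case by (simp add: C_diff_0)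
next
  case (Suc n)
  then have "partial b (\<lambda>x. u x + v x) = (\<lambda>x. partial b u x + partial b v x)" for b
    by (intro ext partial_add C_diff_differentiable)
  with Suc show ?case by (simp add: C_diff_Suc)
qed

lemma C_diff_mult:
  "C_diff n u \<Longrightarrow> C_diff n v \<Longrightarrow> C_diff n (\<lambda>x. u x * v x)"
proof (induction n arbitrary: u v)
  case 0 then show ?case by (simp add: C_diff_0 differentiable_mult)
next
  case (Suc n)
  then have "partial b (\<lambda>x. u x * v x) = (\<lambda>x. partial b u x * v x + u x * partial b v x)" for b
    by (intro ext partial_mult C_diff_differentiable)
  moreover have "C_diff n u" "C_diff n v" using Suc.prems C_diff_mono by blast+
  ultimately show ?case
    using Suc.prems by (simp add: C_diff_Suc differentiable_mult C_diff_add Suc.IH)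
qed

lemma smooth_add: "smooth u \<Longrightarrow> smooth v \<Longrightarrow> smooth (\<lambda>x. u x + v x)"
  by (simp add: smooth_iff_C_diff C_diff_add)

lemma smooth_mult: "smooth u \<Longrightarrow> smooth v \<Longrightarrow> smooth (\<lambda>x. u x * v x)"
  by (simp add: smooth_iff_C_diff C_diff_mult)

lemma smooth_sum: "(\<And>i. i \<in> I \<Longrightarrow> smooth (u i)) \<Longrightarrow> smooth (\<lambda>x. \<Sum>i\<in>I. u i x)"
  by (induction I rule: infinite_finite_induct) (auto intro: smooth_add simp: smooth_const)

lemma has_derivative_gaussian:
  "((\<lambda>x::'a::euclidean_space. exp (- j * (norm x)\<^sup>2)) has_derivative
     (\<lambda>h. - 2 * j * (x \<bullet> h) * exp (- j * (norm x)\<^sup>2))) (at x)"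
  unfolding power2_norm_eq_inner
  by (auto intro!: derivative_eq_intros simp: inner_commute algebra_simps)

lemma partial_gaussian:
  "partial b (\<lambda>x. exp (- j * (norm x)\<^sup>2)) x = - 2 * j * (x \<bullet> b) * exp (- j * (norm x)\<^sup>2)"
  by (rule partial_eq[OF has_derivative_gaussian])

text \<open>Each partial derivative of the Gaussian is a linear factor times the Gaussian, so order
  n for the function yields order n for its derivatives, that is, order n + 1 for the
  function.\<close>

lemma smooth_gaussian: "smooth (\<lambda>x::'a::euclidean_space. exp (- j * (norm x)\<^sup>2))" (is "smooth ?s")
proof -
  have "C_diff n ?s" for n
  proof (induction n)
    case 0 then show ?case
      unfolding C_diff_0 differentiable_def using has_derivative_gaussian by blast
  next
    case (Suc n)
    have "C_diff n (partial b ?s)" for b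
      unfolding partial_gaussian[abs_def]
      using C_diff_mult[OF C_diff_mult[of n "\<lambda>x. - 2 * j" "\<lambda>x. x \<bullet> b"] Suc]
        smooth_const[of "- 2 * j"] smooth_inner[of b] unfolding smooth_iff_C_diff by blast
    then show ?case unfolding C_diff_Suc differentiable_def using has_derivative_gaussian by blast
  qed
  then show ?thesis by (simp add: smooth_iff_C_diff)
qed

section \<open>Symmetry of mixed second partial derivatives\<close>

lemma has_real_derivative_along_line:
  assumes "u differentiable (at (x + t *\<^sub>R a))"
  shows "((\<lambda>t. u (x + t *\<^sub>R a)) has_real_derivative grad u (x + t *\<^sub>R a) \<bullet> a) (at t within S)"
proof -
  have "((\<lambda>t. u (x + t *\<^sub>R a)) has_derivative (\<lambda>h. grad u (x + t *\<^sub>R a) \<bullet> (h *\<^sub>R a))) (at t within S)"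
    by (rule has_derivative_compose[of "\<lambda>t. x + t *\<^sub>R a", OF _ has_derivative_grad[OF assms]])
       (auto intro!: derivative_eq_intros)
  then show ?thesis unfolding has_field_derivative_def
    by (rule has_derivative_eq_rhs) (simp add: fun_eq_iff)
qed

text \<open>Two applications of the mean value theorem: in direction a to the difference of u on two
  parallel segments, then in direction b to \<open>partial a u\<close>. The left side is symmetric
  in a and b while the order of differentiation on the right is not, which is what
  \<open>partial_commute\<close> exploits.\<close>

lemma second_difference:
  assumes u: "smooth u" and ab: "a \<in> Basis" "b \<in> Basis" and h: "h > 0"
  shows "\<exists>s t. 0 < s \<and> s < h \<and> 0 < t \<and> t < h \<and>
    u (x + h *\<^sub>R a + h *\<^sub>R b) - u (x + h *\<^sub>R a) - u (x + h *\<^sub>R b) + u x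
      = h\<^sup>2 * partial b (partial a u) (x + s *\<^sub>R a + t *\<^sub>R b)"
proof -
  have du: "u differentiable (at y)" "partial a u differentiable (at y)" for y
    using u ab smoothD smooth_partial by blast+
  let ?f = "\<lambda>s. u ((x + h *\<^sub>R b) + s *\<^sub>R a) - u (x + s *\<^sub>R a)"
  have "\<exists>s>0. s < h \<and> ?f h - ?f 0 =
      (h - 0) * (partial a u ((x + h *\<^sub>R b) + s *\<^sub>R a) - partial a u (x + s *\<^sub>R a))"
    using h DERIV_diff[OF has_real_derivative_along_line[OF du(1), where x = "x + h *\<^sub>R b" and a = a]
        has_real_derivative_along_line[OF du(1), where x = x and a = a]]
    by (intro MVT2) (auto simp: grad_inner_Basis ab)
  then obtain s where s: "0 < s" "s < h" and
    1: "?f h - ?f 0 = h * (partial a u ((x + h *\<^sub>R b) + s *\<^sub>R a) - partial a u (x + s *\<^sub>R a))"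
    by auto
  let ?g = "\<lambda>t. partial a u ((x + s *\<^sub>R a) + t *\<^sub>R b)"
  have "\<exists>t>0. t < h \<and> ?g h - ?g 0 = (h - 0) * partial b (partial a u) (x + s *\<^sub>R a + t *\<^sub>R b)"
    using h has_real_derivative_along_line[OF du(2), where x = "x + s *\<^sub>R a" and a = b]
    by (intro MVT2) (auto simp: grad_inner_Basis ab)
  then obtain t where t: "0 < t" "t < h" and
    2: "?g h - ?g 0 = h * partial b (partial a u) (x + s *\<^sub>R a + t *\<^sub>R b)" by auto
  have "?f h - ?f 0 = h * (?g h - ?g 0)" unfolding 1 by (simp add: algebra_simps)
  then have "?f h - ?f 0 = h\<^sup>2 * partial b (partial a u) (x + s *\<^sub>R a + t *\<^sub>R b)"
    unfolding 2 by (simp add: power2_eq_square)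
  then show ?thesis using s t by (intro exI[of _ s] exI[of _ t]) (simp add: algebra_simps)
qed

lemma partial_commute:
  assumes u: "smooth u" and ab: "a \<in> Basis" "b \<in> Basis"
  shows "partial a (partial b u) x = partial b (partial a u) x"
proof -
  let ?F = "partial b (partial a u)" and ?G = "partial a (partial b u)"
  have sm: "smooth ?F" "smooth ?G" using u ab smooth_partial by blast+
  have "\<exists>y z. dist y x < 2 / Suc n \<and> dist z x < 2 / Suc n \<and> ?F y = ?G z" for n :: nat
  proof -
    \<comment> \<open>The intermediate points lie within s + t < 2h of x, hence converge to x as n
      grows; continuity of both mixed derivatives then gives equality at x.\<close>
    define h :: real where "h = 1 / Suc n"
    have h: "h > 0" by (simp add: h_def)
    have d: "dist (x + s *\<^sub>R c + t *\<^sub>R d) x < 2 / Suc n"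
      if "0 < s" "s < h" "0 < t" "t < h" "c \<in> Basis" "d \<in> Basis" for s t c d
    proof -
      have "norm (s *\<^sub>R c + t *\<^sub>R d) \<le> s + t"
        using that norm_triangle_ineq[of "s *\<^sub>R c" "t *\<^sub>R d"] by simp
      then show ?thesis using that by (simp add: dist_norm h_def add.assoc)
    qed
    obtain s t where st: "0 < s" "s < h" "0 < t" "t < h" and
      1: "u (x + h *\<^sub>R a + h *\<^sub>R b) - u (x + h *\<^sub>R a) - u (x + h *\<^sub>R b) + u x
        = h\<^sup>2 * ?F (x + s *\<^sub>R a + t *\<^sub>R b)"
      using second_difference[OF u ab h] by blast
    obtain s' t' where st': "0 < s'" "s' < h" "0 < t'" "t' < h" and
      2: "u (x + h *\<^sub>R b + h *\<^sub>R a) - u (x + h *\<^sub>R b) - u (x + h *\<^sub>R a) + u x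
        = h\<^sup>2 * ?G (x + s' *\<^sub>R b + t' *\<^sub>R a)"
      using second_difference[OF u ab(2,1) h] by blast
    have "h\<^sup>2 * ?F (x + s *\<^sub>R a + t *\<^sub>R b) = h\<^sup>2 * ?G (x + s' *\<^sub>R b + t' *\<^sub>R a)"
      unfolding 1[symmetric] 2[symmetric] by (simp add: algebra_simps)
    then have "?F (x + s *\<^sub>R a + t *\<^sub>R b) = ?G (x + s' *\<^sub>R b + t' *\<^sub>R a)" using h by simp
    then show ?thesis using d[OF st ab] d[OF st' ab(2,1)] by blast
  qed
  then obtain y z where yz: "\<And>n::nat. dist (y n) x < 2 / Suc n" "\<And>n. dist (z n) x < 2 / Suc n"
      "\<And>n. ?F (y n) = ?G (z n)" by metis
  have lim: "(\<lambda>n. 2 / Suc n) \<longlonglongrightarrow> (0::real)"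
    using tendsto_mult_right_zero[OF LIMSEQ_inverse_real_of_nat, of 2] by (simp add: divide_inverse)
  have "y \<longlonglongrightarrow> x" "z \<longlonglongrightarrow> x"
    unfolding tendsto_dist_iff[of _ x]
    by (rule tendsto_sandwich[OF _ _ tendsto_const lim];
        intro always_eventually allI zero_le_dist less_imp_le yz)+
  then have "(\<lambda>n. ?F (y n)) \<longlonglongrightarrow> ?F x" "(\<lambda>n. ?G (z n)) \<longlonglongrightarrow> ?G x"
    using sm[THEN smooth_continuous, of UNIV]
    by (auto simp: continuous_on_eq_continuous_at isCont_def intro: isCont_tendsto_compose)
  then show ?thesis using LIMSEQ_unique yz(3) by auto
qed

section \<open>Normals of a convex domain\<close>

lemma has_derivative_grad_field:
  assumes "smooth u"
  shows "(grad u has_derivative (\<lambda>h. \<Sum>b\<in>Basis. (grad (partial b u) x \<bullet> h) *\<^sub>R b)) (at x)"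
  unfolding grad_def[of u, abs_def]
  using assms
  by (intro has_derivative_sum has_derivative_scaleR_left has_derivative_grad smoothD smooth_partial)

lemma continuous_on_grad: "smooth u \<Longrightarrow> continuous_on S (grad u)"
  by (meson has_derivative_grad_field has_derivative_continuous_on has_derivative_at_withinI)

lemma grad_minus: "u differentiable (at x) \<Longrightarrow> grad (\<lambda>x. - u x) x = - grad u x"
  using partial_eq[OF has_derivative_minus[OF has_derivative_grad[of u x]]]
  unfolding grad_def[of "\<lambda>x. - u x"]
  by (simp add: grad_inner_Basis sum_negf grad_def[of u x, symmetric] flip: grad_def)

lemma smooth_minus: "smooth u \<Longrightarrow> smooth (\<lambda>x. - u x)"
  using smooth_mult[OF smooth_const[of "-1"]] by simp

text \<open>The strict inequality persists near (p, w) by continuity, and the mean value theorem on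
  the segment from x to x + h w' turns it into a strict decrease. Uniformity in x, w' and h is
  needed for the moving base points and directions in \<open>flow_stays_close\<close>.\<close>

lemma smooth_descent:
  assumes \<rho>: "smooth \<rho>" and w: "grad \<rho> p \<bullet> w < 0" and U: "open U" "p \<in> U"
  shows "\<exists>\<delta>>0. \<forall>x w' h. dist x p < \<delta> \<longrightarrow> dist w' w < \<delta> \<longrightarrow> 0 < h \<longrightarrow> h < \<delta> \<longrightarrow>
    x + h *\<^sub>R w' \<in> U \<and> \<rho> (x + h *\<^sub>R w') < \<rho> x"
proof -
  have "isCont (grad \<rho>) (fst (p, w))"
    using continuous_on_grad[OF \<rho>, of UNIV] by (simp add: continuous_on_eq_continuous_at)
  then have "isCont (\<lambda>z. grad \<rho> (fst z)) (p, w)" 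
    by (rule isCont_o2[OF isCont_fst[OF continuous_ident]])
  then have "isCont (\<lambda>z. grad \<rho> (fst z) \<bullet> snd z) (p, w)" 
    by (rule continuous_inner[OF _ isCont_snd[OF continuous_ident]])
  then have "((\<lambda>z. grad \<rho> (fst z) \<bullet> snd z) \<longlongrightarrow> grad \<rho> p \<bullet> w) (nhds (p, w))"
    using tendsto_at_iff_tendsto_nhds[of "\<lambda>z. grad \<rho> (fst z) \<bullet> snd z" "(p, w)"]
    by (simp add: isCont_def)
  then have "\<forall>\<^sub>F z in nhds (p, w). grad \<rho> (fst z) \<bullet> snd z < 0"
    using w by (rule order_tendstoD(2))
  then obtain d1 where d1: "d1 > 0" "\<And>y w'. dist (y, w') (p, w) < d1 \<Longrightarrow> grad \<rho> y \<bullet> w' < 0"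
    unfolding eventually_nhds_metric by fastforce
  obtain d2 where d2: "d2 > 0" "ball p d2 \<subseteq> U" using U openE by blast
  \<comment> \<open>\<open>\<delta> * (norm w + 2) = m / 2\<close> covers the initial offset plus a
    displacement of length at most \<open>\<delta> * (norm w + 1)\<close>, so the segment stays
    within m of p. The three bounds in m give \<open>norm w' \<le> norm w + 1\<close>, the range
    \<open>d1\<close> of negative slope, and the ball inside U.\<close>
  define m where "m = min 1 (min (d1 / 2) d2)"
  define K where "K = norm w + 2"
  define \<delta> where "\<delta> = m / (2 * K)"
  have nw: "norm w + 2 > 0" "norm w + 2 \<ge> 1" by (auto intro: add_nonneg_pos)
  have m: "m > 0" "m \<le> d2" "2 * m \<le> d1" "m \<le> 1" using d1 d2 by (auto simp: m_def)
  have \<delta>: "\<delta> > 0" "\<delta> * (norm w + 2) = m / 2"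
    using m(1) nw(1) by (simp_all add: \<delta>_def K_def[symmetric])
  have "\<delta> \<le> \<delta> * (norm w + 2)" using \<delta>(1) nw(2) by (simp add: mult_le_cancel_left1)
  then have \<delta>m: "\<delta> \<le> m / 2" using \<delta>(2) by simp
  show ?thesis
  proof (intro exI[of _ \<delta>] conjI allI impI)
    fix x w' h assume x: "dist x p < \<delta>" and w': "dist w' w < \<delta>" and h: "0 < h" "h < \<delta>"
    have nw': "norm w' \<le> norm w + 1"
      using w' \<delta>m m norm_triangle_sub[of w' w] by (simp add: dist_norm)
    have close: "dist (x + t *\<^sub>R w') p < m" if "0 \<le> t" "t \<le> h" for t
    proof -
      have "dist (x + t *\<^sub>R w') p \<le> dist x p + t * norm w'"
        using that norm_triangle_ineq[of "x - p" "t *\<^sub>R w'"] by (simp add: dist_norm algebra_simps)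
      also have "t * norm w' \<le> \<delta> * (norm w + 1)"
        using that h nw' by (intro mult_mono) auto
      finally show ?thesis using x \<delta>(2) m(1) by (simp add: algebra_simps)
    qed
    show "x + h *\<^sub>R w' \<in> U" using close[of h] h m(2) d2(2) by (auto simp: dist_commute)
    let ?f = "\<lambda>t. \<rho> (x + t *\<^sub>R w')"
    have "\<exists>t>0. t < h \<and> ?f h - ?f 0 = (h - 0) * (grad \<rho> (x + t *\<^sub>R w') \<bullet> w')"
      using h \<rho> by (intro MVT2 has_real_derivative_along_line smoothD)
    then obtain t where t: "0 < t" "t < h" "?f h - ?f 0 = h * (grad \<rho> (x + t *\<^sub>R w') \<bullet> w')" by auto
    have "dist (x + t *\<^sub>R w', w') (p, w) \<le> dist (x + t *\<^sub>R w') p + dist w' w"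
      unfolding dist_Pair_Pair by (intro sqrt_sum_squares_le_sum) auto
    also have "\<dots> < d1" using close[of t] t w' \<delta>m m by simp
    finally have "grad \<rho> (x + t *\<^sub>R w') \<bullet> w' < 0" by (rule d1(2))
    then have "?f h - ?f 0 < 0" unfolding t(3) using h by (simp add: mult_pos_neg)
    then show "\<rho> (x + h *\<^sub>R w') < \<rho> x" by simp
  qed (rule \<delta>)
qed

section \<open>Defining functions, supporting hyperplanes and displacement along non-outward
  fields\<close>

lemma local_defining_functionD:
  assumes "local_defining_function \<Omega> p \<rho>"
  shows "\<exists>U. smooth \<rho> \<and> grad \<rho> p \<noteq> 0 \<and> open U \<and> p \<in> U \<and> (\<forall>x\<in>U. x \<in> \<Omega> \<longleftrightarrow> \<rho> x < 0)"
proof -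
  obtain U where U: "smooth \<rho>" "grad \<rho> p \<noteq> 0" "open U" "p \<in> U" "\<Omega> \<inter> U = {x \<in> U. \<rho> x < 0}"
    using assms unfolding local_defining_function_def by blast
  have "x \<in> \<Omega> \<longleftrightarrow> \<rho> x < 0" if "x \<in> U" for x
    using that U(5) by (auto simp: set_eq_iff)
  then show ?thesis using U(1-4) by blast
qed

text \<open>Inside U the set where \<open>\<rho>\<close> is positive is open and misses the domain,
  so it misses the closure as well.\<close>

lemma local_defining_function_closure:
  assumes "smooth \<rho>" "open U" "\<And>x. x \<in> U \<Longrightarrow> x \<in> \<Omega> \<longleftrightarrow> \<rho> x < 0" "x \<in> U" "x \<in> closure \<Omega>"
  shows "\<rho> x \<le> 0"
proof (rule ccontr)
  assume "\<not> \<rho> x \<le> 0"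
  have "open (U \<inter> {x. \<rho> x > 0})"
    using smooth_continuous[OF assms(1), of UNIV] assms(2)
    by (intro open_Int open_Collect_less) auto
  moreover have "x \<in> U \<inter> {x. \<rho> x > 0}" using assms \<open>\<not> \<rho> x \<le> 0\<close> by auto
  moreover have "\<Omega> \<inter> (U \<inter> {x. \<rho> x > 0}) = {}" using assms(3) by fastforce
  ultimately show False using assms(5) by (metis IntI emptyE inf_commute open_Int_closure_eq_empty)
qed

lemma local_defining_function_frontier:
  assumes "open \<Omega>" "p \<in> frontier \<Omega>" "smooth \<rho>" "open U" "p \<in> U"
    "\<And>x. x \<in> U \<Longrightarrow> x \<in> \<Omega> \<longleftrightarrow> \<rho> x < 0"
  shows "\<rho> p = 0"
proof -
  have "p \<in> closure \<Omega>" "p \<notin> \<Omega>" using assms by (auto simp: frontier_def interior_open)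
  then show ?thesis using local_defining_function_closure[OF assms(3,4,6,5)] assms(5,6) by force
qed

text \<open>If the product were positive, a short step from p towards y would raise
  \<open>\<rho>\<close> above \<open>\<rho> p = 0\<close>; but by convexity that step ends in the
  closure, where \<open>\<rho> \<le> 0\<close> near p.\<close>

lemma supporting_normal:
  assumes \<Omega>: "open \<Omega>" "convex \<Omega>" and p: "p \<in> frontier \<Omega>" "local_defining_function \<Omega> p \<rho>"
    and y: "y \<in> closure \<Omega>"
  shows "grad \<rho> p \<bullet> (y - p) \<le> 0"
proof (rule ccontr)
  assume neg: "\<not> grad \<rho> p \<bullet> (y - p) \<le> 0"
  obtain U where U: "smooth \<rho>" "open U" "p \<in> U" "\<And>x. x \<in> U \<Longrightarrow> x \<in> \<Omega> \<longleftrightarrow> \<rho> x < 0"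
    using local_defining_functionD[OF p(2)] by blast
  have "grad (\<lambda>x. - \<rho> x) p \<bullet> (y - p) < 0" using neg U by (simp add: grad_minus smoothD)
  from smooth_descent[OF smooth_minus[OF U(1)] this U(2,3)] obtain \<delta> where
    \<delta>: "\<delta> > 0" "\<And>h. 0 < h \<Longrightarrow> h < \<delta> \<Longrightarrow> p + h *\<^sub>R (y - p) \<in> U \<and> \<rho> p < \<rho> (p + h *\<^sub>R (y - p))"
    by (metis dist_self neg_less_iff_less)
  define h where "h = min (\<delta> / 2) 1"
  have h: "0 < h" "h < \<delta>" "h \<le> 1" using \<delta> by (auto simp: h_def)
  have "p + h *\<^sub>R (y - p) = (1 - h) *\<^sub>R p + h *\<^sub>R y" by (simp add: algebra_simps)
  also have "\<dots> \<in> closure \<Omega>"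
    using h p y convex_closure[OF \<Omega>(2)] by (intro convexD) (auto simp: frontier_def)
  finally have "\<rho> (p + h *\<^sub>R (y - p)) \<le> 0"
    using local_defining_function_closure[OF U(1,2,4)] \<delta>(2) h by blast
  then show False
    using \<delta>(2)[OF h(1,2)] local_defining_function_frontier[OF \<Omega>(1) p(1) U] by simp
qed

text \<open>As X may be tangent to the boundary, x + h X(x) can leave the domain, but only by o(h).
  A sequence violating this would accumulate at some q in the compact closure. For q inside, the
  displaced points themselves lie in the domain; for q on the boundary, an additional inward push of
  size e h puts them there.\<close>

lemma flow_stays_close:
  assumes \<Omega>: "open \<Omega>" "bounded \<Omega>" "smooth_boundary \<Omega>" and X: "continuous_on UNIV X"
    and inward: "\<And>p \<rho>. p \<in> frontier \<Omega> \<Longrightarrow> local_defining_function \<Omega> p \<rho> \<Longrightarrow> grad \<rho> p \<bullet> X p \<le> 0"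
    and e: "e > 0"
  shows "\<exists>\<delta>>0. \<forall>h x. 0 < h \<longrightarrow> h < \<delta> \<longrightarrow> x \<in> \<Omega> \<longrightarrow> (\<exists>z\<in>\<Omega>. dist (x + h *\<^sub>R X x) z \<le> e * h)"
proof (rule ccontr)
  assume "\<not> ?thesis"
  then have "\<exists>h x. 0 < h \<and> h < 1 / Suc n \<and> x \<in> \<Omega> \<and> (\<forall>z\<in>\<Omega>. dist (x + h *\<^sub>R X x) z > e * h)"
    for n :: nat by (metis not_less of_nat_0_less_iff zero_less_Suc zero_less_divide_1_iff)
  then obtain h x where h: "\<And>n::nat. 0 < h n" "\<And>n. h n < 1 / Suc n" and x: "\<And>n. x n \<in> \<Omega>"
    and far: "\<And>n z. z \<in> \<Omega> \<Longrightarrow> dist (x n + h n *\<^sub>R X (x n)) z > e * h n" by metis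
  have "compact (closure \<Omega>)" using \<Omega> by simp
  then obtain q r where q: "q \<in> closure \<Omega>" and r: "strict_mono r" and xr: "(x \<circ> r) \<longlonglongrightarrow> q"
    unfolding compact_def using x closure_subset by (metis subsetD)
  have "h \<longlonglongrightarrow> 0"
    using h less_imp_le
    by (intro tendsto_sandwich[OF _ _ tendsto_const LIMSEQ_inverse_real_of_nat])
       (auto intro!: always_eventually simp: divide_inverse simp del: of_nat_Suc)
  then have hr: "(\<lambda>n. h (r n)) \<longlonglongrightarrow> 0" using LIMSEQ_subseq_LIMSEQ[OF _ r] by (simp add: o_def)
  have xr: "(\<lambda>n. x (r n)) \<longlonglongrightarrow> q" using xr by (simp add: o_def)
  have "isCont X q" using X by (simp add: continuous_on_eq_continuous_at)
  then have Xr: "(\<lambda>n. X (x (r n))) \<longlonglongrightarrow> X q" using xr by (rule isCont_tendsto_compose)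
  show False
  proof (cases "q \<in> \<Omega>")
    case True
    have "(\<lambda>n. x (r n) + h (r n) *\<^sub>R X (x (r n))) \<longlonglongrightarrow> q + 0 *\<^sub>R X q"
      by (intro tendsto_intros xr hr Xr)
    then have "\<forall>\<^sub>F n in sequentially. x (r n) + h (r n) *\<^sub>R X (x (r n)) \<in> \<Omega>"
      using True \<Omega>(1) by (intro topological_tendstoD[of _ q]) auto
    then obtain n where "x (r n) + h (r n) *\<^sub>R X (x (r n)) \<in> \<Omega>" by (meson eventually_happens trivial_limit_sequentially)
    from far[OF this, of "r n"] show False using h(1)[of "r n"] e by (simp add: mult_less_0_iff)
  next
    case False
    then have qf: "q \<in> frontier \<Omega>" using q \<Omega>(1) by (simp add: frontier_def interior_open)
    then obtain \<rho> where \<rho>: "local_defining_function \<Omega> q \<rho>" using \<Omega>(3) unfolding smooth_boundary_def by blast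
    obtain U where U: "smooth \<rho>" "grad \<rho> q \<noteq> 0" "open U" "q \<in> U" "\<And>x. x \<in> U \<Longrightarrow> x \<in> \<Omega> \<longleftrightarrow> \<rho> x < 0"
      using local_defining_functionD[OF \<rho>] by blast
    let ?\<nu> = "grad \<rho> q /\<^sub>R norm (grad \<rho> q)"
    \<comment> \<open>Tilting by e along the unit normal makes the slope strictly negative even if
      X(q) is tangent, and moves the displaced point by exactly e h.\<close>
    have "grad \<rho> q \<bullet> (X q - e *\<^sub>R ?\<nu>) = grad \<rho> q \<bullet> X q - e * norm (grad \<rho> q)"
      using U(2) by (simp add: inner_diff_right dot_square_norm power2_eq_square)
    also have "\<dots> < 0"
      using inward[OF qf \<rho>] mult_pos_pos[OF e, of "norm (grad \<rho> q)"] U(2)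
      unfolding zero_less_norm_iff by linarith
    finally obtain \<delta> where \<delta>: "\<delta> > 0" "\<And>x w' h. dist x q < \<delta> \<Longrightarrow> dist w' (X q - e *\<^sub>R ?\<nu>) < \<delta> \<Longrightarrow> 0 < h \<Longrightarrow> h < \<delta>
       \<Longrightarrow> x + h *\<^sub>R w' \<in> U \<and> \<rho> (x + h *\<^sub>R w') < \<rho> x"
      using smooth_descent[OF U(1) _ U(3,4)] by blast
    have "(\<lambda>n. X (x (r n)) - e *\<^sub>R ?\<nu>) \<longlonglongrightarrow> X q - e *\<^sub>R ?\<nu>" by (intro tendsto_intros Xr)
    from tendstoD[OF this \<delta>(1)] tendstoD[OF xr \<delta>(1)] tendstoD[OF hr \<delta>(1)]
      topological_tendstoD[OF xr U(3,4)]
    have "\<forall>\<^sub>F n in sequentially. x (r n) + h (r n) *\<^sub>R (X (x (r n)) - e *\<^sub>R ?\<nu>) \<in> \<Omega>"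
    proof eventually_elim
      case (elim n)
      have "h (r n) < \<delta>" using elim(3) h(1)[of "r n"] by (simp add: dist_real_def)
      from \<delta>(2)[OF elim(2,1) h(1) this] have
        "x (r n) + h (r n) *\<^sub>R (X (x (r n)) - e *\<^sub>R ?\<nu>) \<in> U"
        "\<rho> (x (r n) + h (r n) *\<^sub>R (X (x (r n)) - e *\<^sub>R ?\<nu>)) < \<rho> (x (r n))" by blast+
      moreover have "\<rho> (x (r n)) < 0" using elim(4) U(5) x by blast
      ultimately show ?case using U(5) less_trans by blast
    qed
    then obtain n where n: "x (r n) + h (r n) *\<^sub>R (X (x (r n)) - e *\<^sub>R ?\<nu>) \<in> \<Omega>"
      by (meson eventually_happens trivial_limit_sequentially)
    have "dist (x (r n) + h (r n) *\<^sub>R X (x (r n))) (x (r n) + h (r n) *\<^sub>R (X (x (r n)) - e *\<^sub>R ?\<nu>))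
       = e * h (r n)" using e h(1)[of "r n"] U(2) by (simp add: dist_norm scaleR_diff_right)
    then show False using far[OF n, of "r n"] by simp
  qed
qed

text \<open>The points q k need not lie on a line; only the quotients (q k - p) / s k converge. This
  allows differentiation along the boundary without a parametrization of it.\<close>

lemma has_derivative_quotient_sequence:
  fixes F :: "'a::real_normed_vector \<Rightarrow> 'b::real_normed_vector"
  assumes F: "(F has_derivative D) (at p)" and s: "\<And>k. s k > 0" "s \<longlonglongrightarrow> (0::real)"
    and q: "(\<lambda>k. (q k - p) /\<^sub>R s k) \<longlonglongrightarrow> \<tau>"
  shows "(\<lambda>k. (F (q k) - F p) /\<^sub>R s k) \<longlonglongrightarrow> D \<tau>"
proof -
  interpret D: bounded_linear D using F by (rule has_derivative_bounded_linear)
  have "(\<lambda>k. s k *\<^sub>R ((q k - p) /\<^sub>R s k)) \<longlonglongrightarrow> 0 *\<^sub>R \<tau>" by (intro tendsto_intros s q)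
  moreover have "s k *\<^sub>R ((q k - p) /\<^sub>R s k) = q k - p" for k using s(1)[of k] by simp
  ultimately have qp: "(\<lambda>k. q k - p) \<longlonglongrightarrow> 0" by simp
  obtain C where C: "C > 0" "\<And>k. norm ((q k - p) /\<^sub>R s k) \<le> C"
    using BseqD[OF convergent_imp_Bseq[OF convergentI[OF q]]] by blast
  have "(\<lambda>k. (F (q k) - F p) /\<^sub>R s k - D ((q k - p) /\<^sub>R s k)) \<longlonglongrightarrow> 0"
  proof (rule tendstoI, goal_cases)
    case (1 e)
    \<comment> \<open>C bounds the quotients, so the linearization error divided by s k is at most
      e' C = e / 2.\<close>
    define e' where "e' = e / (2 * C)"
    have e': "e' > 0" "e' * C < e" using 1 C by (auto simp: e'_def field_simps)
    obtain d where d: "d > 0" "\<And>y. norm (y - p) < d \<Longrightarrow> norm (F y - F p - D (y - p)) \<le> e' * norm (y - p)"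
      using F e'(1) unfolding has_derivative_at_alt by metis
    from tendstoD[OF qp d(1)] show ?case
    proof eventually_elim
      case (elim k)
      then have "norm (F (q k) - F p - D (q k - p)) \<le> e' * norm (q k - p)" using d by simp
      then have "norm (F (q k) - F p - D (q k - p)) / s k \<le> e' * (norm (q k - p) / s k)"
        using s(1)[of k] by (simp add: divide_right_mono)
      also have "\<dots> \<le> e' * C" using C(2)[of k] e'(1) s(1)[of k]
        by (intro mult_left_mono) (auto simp: divide_inverse_commute)
      also have "norm (F (q k) - F p - D (q k - p)) / s k
          = norm ((F (q k) - F p) /\<^sub>R s k - D ((q k - p) /\<^sub>R s k))"
        using s(1)[of k]
        by (simp add: D.scaleR scaleR_diff_right[symmetric] divide_inverse_commute)
      finally show ?case using e' by (simp add: dist_norm)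
    qed
  qed
  from tendsto_add[OF this D.tendsto[OF q]] show ?thesis by simp
qed

text \<open>Serves in place of a boundary curve with velocity \<open>\<tau>\<close>: for small s the
  point \<open>p + s (\<tau> - \<nu>)\<close> lies in the domain and
  \<open>p + s (\<tau> + \<nu>)\<close> outside, so the segment joining them crosses the
  frontier.\<close>

lemma frontier_point_near_tangent:
  assumes \<Omega>: "open \<Omega>" and p: "p \<in> frontier \<Omega>" "local_defining_function \<Omega> p \<rho>"
    and \<tau>: "grad \<rho> p \<bullet> \<tau> = 0" and e: "e > 0"
  shows "\<exists>s q. 0 < s \<and> s < e \<and> q \<in> frontier \<Omega> \<and> dist ((q - p) /\<^sub>R s) \<tau> < e"
proof -
  obtain U where U: "smooth \<rho>" "grad \<rho> p \<noteq> 0" "open U" "p \<in> U" "\<And>x. x \<in> U \<Longrightarrow> x \<in> \<Omega> \<longleftrightarrow> \<rho> x < 0"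
    using local_defining_functionD[OF p(2)] by blast
  have \<rho>p: "\<rho> p = 0" by (rule local_defining_function_frontier[OF \<Omega> p(1) U(1,3-5)])
  \<comment> \<open>Length e / 2 keeps the direction of the crossing point, which is
    \<open>\<tau> + (2 * u - 1) *\<^sub>R \<nu>\<close>, strictly within e of
    \<open>\<tau>\<close>.\<close>
  define \<nu> where "\<nu> = (e / 2) *\<^sub>R (grad \<rho> p /\<^sub>R norm (grad \<rho> p))"
  have \<nu>: "norm \<nu> = e / 2" using U(2) e by (simp add: \<nu>_def)
  have g: "grad \<rho> p \<bullet> \<nu> > 0" using U(2) e by (simp add: \<nu>_def dot_square_norm)
  have "grad \<rho> p \<bullet> (\<tau> - \<nu>) < 0" "grad (\<lambda>x. - \<rho> x) p \<bullet> (\<tau> + \<nu>) < 0"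
    using g \<tau> U(1) by (auto simp: grad_minus smoothD inner_diff_right inner_add_right)
  from smooth_descent[OF U(1) this(1) U(3,4)] smooth_descent[OF smooth_minus[OF U(1)] this(2) U(3,4)]
  obtain d1 d2 where
    d1: "d1 > 0" "\<And>h. 0 < h \<Longrightarrow> h < d1 \<Longrightarrow> p + h *\<^sub>R (\<tau> - \<nu>) \<in> U \<and> \<rho> (p + h *\<^sub>R (\<tau> - \<nu>)) < \<rho> p" and
    d2: "d2 > 0" "\<And>h. 0 < h \<Longrightarrow> h < d2 \<Longrightarrow> p + h *\<^sub>R (\<tau> + \<nu>) \<in> U \<and> - \<rho> (p + h *\<^sub>R (\<tau> + \<nu>)) < - \<rho> p"
    by (metis dist_self)
  define s where "s = min (min d1 d2) e / 2"
  have s: "0 < s" "s < d1" "s < d2" "s < e" using d1 d2 e by (auto simp: s_def)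
  let ?a = "p + s *\<^sub>R (\<tau> - \<nu>)" and ?b = "p + s *\<^sub>R (\<tau> + \<nu>)"
  have "?a \<in> \<Omega>" "?b \<notin> \<Omega>" using d1(2)[of s] d2(2)[of s] s U(5) \<rho>p by fastforce+
  then have "closed_segment ?a ?b \<inter> frontier \<Omega> \<noteq> {}"
    by (intro connected_Int_frontier) (auto simp: connected_segment)
  then obtain q where q: "q \<in> frontier \<Omega>" "q \<in> closed_segment ?a ?b" by blast
  then obtain u where u: "0 \<le> u" "u \<le> 1" "q = (1 - u) *\<^sub>R ?a + u *\<^sub>R ?b"
    by (auto simp: in_segment)
  have "q - p = s *\<^sub>R (\<tau> + (2 * u - 1) *\<^sub>R \<nu>)" unfolding u(3) by (simp add: algebra_simps flip: scaleR_add_left)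
  then have "(q - p) /\<^sub>R s = \<tau> + (2 * u - 1) *\<^sub>R \<nu>" using s by simp
  then have "dist ((q - p) /\<^sub>R s) \<tau> = \<bar>2 * u - 1\<bar> * (e / 2)" by (simp add: dist_norm \<nu>)
  also have "\<dots> \<le> 1 * (e / 2)" using u e by (intro mult_right_mono) auto
  finally show ?thesis using s q e by (intro exI[of _ s] exI[of _ q]) auto
qed

lemma neumann_condition_grad:
  assumes "neumann_condition \<Omega> v" "p \<in> frontier \<Omega>" "local_defining_function \<Omega> p \<rho>"
  shows "grad v p \<bullet> grad \<rho> p = 0"
proof -
  have "grad v p \<bullet> (grad \<rho> p /\<^sub>R norm (grad \<rho> p)) = 0"
    using assms unfolding neumann_condition_def outward_unit_normal_def by blast
  moreover have "grad \<rho> p \<noteq> 0" using assms(3) unfolding local_defining_function_def by blast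
  ultimately show ?thesis by simp
qed

text \<open>Differentiating \<open>\<nabla>v \<bullet> \<nabla>\<rho> = 0\<close> along the boundary in the direction \<open>\<tau> = \<nabla>v\<close> gives
  \<open>\<nabla>\<rho> \<bullet> D(\<nabla>v)\<tau> = - D(\<nabla>\<rho>)\<tau> \<bullet> \<tau>\<close>, and the supporting hyperplanes at two boundary points
  show that \<open>\<nabla>\<rho>\<close> is monotone along the boundary.\<close>

lemma neumann_hessian_boundary:
  assumes \<Omega>: "open \<Omega>" "convex \<Omega>" and v: "smooth v" "neumann_condition \<Omega> v"
    and p: "p \<in> frontier \<Omega>" "local_defining_function \<Omega> p \<rho>"
  shows "grad \<rho> p \<bullet> (\<Sum>b\<in>Basis. (grad (partial b v) p \<bullet> grad v p) *\<^sub>R b) \<le> 0"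
proof -
  let ?\<tau> = "grad v p"
  let ?H = "\<lambda>u. \<Sum>b\<in>Basis. (grad (partial b u) p \<bullet> ?\<tau>) *\<^sub>R b"
  obtain U where U: "smooth \<rho>" "grad \<rho> p \<noteq> 0" "open U" "p \<in> U" "\<And>x. x \<in> U \<Longrightarrow> x \<in> \<Omega> \<longleftrightarrow> \<rho> x < 0"
    using local_defining_functionD[OF p(2)] by blast
  have tang: "grad \<rho> p \<bullet> ?\<tau> = 0" using neumann_condition_grad[OF v(2) p] by (simp add: inner_commute)
  have "\<exists>s q. 0 < s \<and> s < 1 / Suc k \<and> q \<in> frontier \<Omega> \<and> dist ((q - p) /\<^sub>R s) ?\<tau> < 1 / Suc k" for k :: nat
    by (rule frontier_point_near_tangent[OF \<Omega>(1) p tang]) simp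
  then obtain s q where s: "\<And>k::nat. 0 < s k" "\<And>k. s k < 1 / Suc k" and
    q: "\<And>k. q k \<in> frontier \<Omega>" "\<And>k. dist ((q k - p) /\<^sub>R s k) ?\<tau> < 1 / Suc k" by metis
  have lim: "(\<lambda>k. 1 / Suc k) \<longlonglongrightarrow> (0::real)" using LIMSEQ_inverse_real_of_nat by (simp add: divide_inverse)
  have s0: "s \<longlonglongrightarrow> 0"
    by (rule tendsto_sandwich[OF _ _ tendsto_const lim]; intro always_eventually allI less_imp_le s)
  have q\<tau>: "(\<lambda>k. (q k - p) /\<^sub>R s k) \<longlonglongrightarrow> ?\<tau>"
    unfolding tendsto_dist_iff[of _ ?\<tau>]
    by (rule tendsto_sandwich[OF _ _ tendsto_const lim];
        intro always_eventually allI zero_le_dist less_imp_le q)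
  have "(\<lambda>k. s k *\<^sub>R ((q k - p) /\<^sub>R s k)) \<longlonglongrightarrow> 0 *\<^sub>R ?\<tau>" by (intro tendsto_intros s0 q\<tau>)
  moreover have "s k *\<^sub>R ((q k - p) /\<^sub>R s k) = q k - p" for k using s(1)[of k] by simp
  ultimately have "(\<lambda>k. q k - p) \<longlonglongrightarrow> 0" by simp
  then have qp: "q \<longlonglongrightarrow> p" using Lim_null by blast
  have cont: "isCont (grad v) p" "isCont (grad \<rho>) p"
    using continuous_on_grad[of _ UNIV] v(1) U(1) by (auto simp: continuous_on_eq_continuous_at)
  have gv: "(\<lambda>k. grad v (q k)) \<longlonglongrightarrow> grad v p" using cont(1) qp by (rule isCont_tendsto_compose)
  have g\<rho>: "(\<lambda>k. grad \<rho> (q k)) \<longlonglongrightarrow> grad \<rho> p" using cont(2) qp by (rule isCont_tendsto_compose)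
  have dv: "(\<lambda>k. (grad v (q k) - grad v p) /\<^sub>R s k) \<longlonglongrightarrow> ?H v"
    by (rule has_derivative_quotient_sequence[OF has_derivative_grad_field[OF v(1)] s(1) s0 q\<tau>])
  have d\<rho>: "(\<lambda>k. (grad \<rho> (q k) - grad \<rho> p) /\<^sub>R s k) \<longlonglongrightarrow> ?H \<rho>"
    by (rule has_derivative_quotient_sequence[OF has_derivative_grad_field[OF U(1)] s(1) s0 q\<tau>])
  \<comment> \<open>For large k the point q k lies in U and the gradient there is nonzero, so the
    same \<open>\<rho>\<close> serves at q k and makes the Neumann condition and the supporting
    hyperplane available there.\<close>
  have ev: "\<forall>\<^sub>F k in sequentially. local_defining_function \<Omega> (q k) \<rho>"
    using topological_tendstoD[OF qp U(3,4)] tendsto_imp_eventually_ne[OF g\<rho> U(2)]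
  proof eventually_elim
    case (elim k)
    then show ?case using U(1,3,5) unfolding local_defining_function_def by blast
  qed
  have "grad \<rho> p \<bullet> ?H v = - (?H \<rho> \<bullet> ?\<tau>)"
  proof (rule LIMSEQ_unique)
    show "(\<lambda>k. grad \<rho> p \<bullet> ((grad v (q k) - grad v p) /\<^sub>R s k)) \<longlonglongrightarrow> grad \<rho> p \<bullet> ?H v"
      by (intro tendsto_intros dv)
    \<comment> \<open>\<open>grad \<rho> \<bullet> grad v\<close> vanishes both at p and at q k, so
      both sides equal \<open>grad \<rho> p \<bullet> grad v (q k)\<close> divided by s k.\<close>
    have "\<forall>\<^sub>F k in sequentially. - (((grad \<rho> (q k) - grad \<rho> p) /\<^sub>R s k) \<bullet> grad v (q k))
        = grad \<rho> p \<bullet> ((grad v (q k) - grad v p) /\<^sub>R s k)"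
      using ev
    proof eventually_elim
      case (elim k)
      then have "grad \<rho> (q k) \<bullet> grad v (q k) = 0"
        using neumann_condition_grad[OF v(2) q(1)] by (simp add: inner_commute)
      then show ?case using tang by (simp add: inner_diff_left inner_diff_right)
    qed
    moreover have "(\<lambda>k. - (((grad \<rho> (q k) - grad \<rho> p) /\<^sub>R s k) \<bullet> grad v (q k))) \<longlonglongrightarrow> - (?H \<rho> \<bullet> ?\<tau>)"
      by (intro tendsto_intros d\<rho> gv)
    ultimately show "(\<lambda>k. grad \<rho> p \<bullet> ((grad v (q k) - grad v p) /\<^sub>R s k)) \<longlonglongrightarrow> - (?H \<rho> \<bullet> ?\<tau>)"
      by (rule Lim_transform_eventually[rotated])
  qed
  moreover have "?H \<rho> \<bullet> ?\<tau> \<ge> 0"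
  proof (rule tendsto_lowerbound)
    show "(\<lambda>k. ((grad \<rho> (q k) - grad \<rho> p) /\<^sub>R s k) \<bullet> ((q k - p) /\<^sub>R s k)) \<longlonglongrightarrow> ?H \<rho> \<bullet> ?\<tau>"
      by (intro tendsto_intros d\<rho> q\<tau>)
    show "\<forall>\<^sub>F k in sequentially. 0 \<le> ((grad \<rho> (q k) - grad \<rho> p) /\<^sub>R s k) \<bullet> ((q k - p) /\<^sub>R s k)"
      using ev
    proof eventually_elim
      case (elim k)
      have "grad \<rho> p \<bullet> (q k - p) \<le> 0" "grad \<rho> (q k) \<bullet> (p - q k) \<le> 0"
        using supporting_normal[OF \<Omega> p, of "q k"] supporting_normal[OF \<Omega> q(1) elim, of p] q(1) p(1)
        by (auto simp: frontier_def)
      then have "0 \<le> (grad \<rho> (q k) - grad \<rho> p) \<bullet> (q k - p)"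
        by (simp add: inner_diff_left inner_diff_right)
      then show ?case using s(1)[of k] by simp
    qed
  qed simp
  ultimately show ?thesis by simp
qed

section \<open>The divergence inequality\<close>

text \<open>The bound is uniform in the numbers a i because they will be the diagonal entries of a
  Jacobian matrix that varies over the domain.\<close>

lemma prod_one_plus_expansion:
  fixes M :: real
  assumes "finite S" "M \<ge> 0"
  shows "\<exists>C\<ge>0. \<forall>a h. (\<forall>i\<in>S. \<bar>a i\<bar> \<le> M) \<longrightarrow> \<bar>h\<bar> \<le> 1 \<longrightarrow>
    \<bar>(\<Prod>i\<in>S. 1 + h * a i) - 1 - h * (\<Sum>i\<in>S. a i)\<bar> \<le> C * h\<^sup>2"
  using assms(1)
proof (induction S)
  case empty
  then show ?case by (intro exI[of _ 0]) simp
next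
  case (insert x S)
  then obtain C where C: "C \<ge> 0" "\<And>a h. (\<forall>i\<in>S. \<bar>a i\<bar> \<le> M) \<Longrightarrow> \<bar>h\<bar> \<le> 1 \<Longrightarrow>
    \<bar>(\<Prod>i\<in>S. 1 + h * a i) - 1 - h * (\<Sum>i\<in>S. a i)\<bar> \<le> C * h\<^sup>2" by blast
  show ?case
  \<comment> \<open>The three terms bound the old remainder R, the new second-order product of a x
    with the sum over S, and the cross term h a x R, where |h| \<le> 1 absorbs the spare power of
    h.\<close>
  proof (intro exI[of _ "C + M * (M * card S) + M * C"] conjI allI impI)
    fix a h assume a: "\<forall>i\<in>insert x S. \<bar>a i\<bar> \<le> M" and h: "\<bar>h\<bar> \<le> (1::real)"
    define R where "R = (\<Prod>i\<in>S. 1 + h * a i) - 1 - h * (\<Sum>i\<in>S. a i)"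
    have R: "\<bar>R\<bar> \<le> C * h\<^sup>2" unfolding R_def using C(2) a h by simp
    have S: "\<bar>\<Sum>i\<in>S. a i\<bar> \<le> M * card S"
      using sum_norm_bound[of S a M] a by (simp add: mult.commute)
    have "(\<Prod>i\<in>insert x S. 1 + h * a i) - 1 - h * (\<Sum>i\<in>insert x S. a i)
        = R + h\<^sup>2 * (a x * (\<Sum>i\<in>S. a i)) + h * (a x * R)"
      using insert.hyps by (simp add: R_def power2_eq_square algebra_simps)
    also have "\<bar>\<dots>\<bar> \<le> \<bar>R\<bar> + h\<^sup>2 * (\<bar>a x\<bar> * \<bar>\<Sum>i\<in>S. a i\<bar>) + \<bar>h\<bar> * (\<bar>a x\<bar> * \<bar>R\<bar>)"
      by (rule order_trans[OF abs_triangle_ineq] add_mono)+ (simp_all add: abs_mult)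
    also have "\<dots> \<le> C * h\<^sup>2 + h\<^sup>2 * (M * (M * card S)) + 1 * (M * (C * h\<^sup>2))"
      using R S a h assms(2) C(1) by (intro add_mono mult_left_mono mult_mono) auto
    finally show "\<bar>(\<Prod>i\<in>insert x S. 1 + h * a i) - 1 - h * (\<Sum>i\<in>insert x S. a i)\<bar>
        \<le> (C + M * (M * card S) + M * C) * h\<^sup>2" by (simp add: algebra_simps)
  qed (use C(1) assms(2) in simp)
qed

text \<open>In the Leibniz expansion the identity contributes 1 + h trace + O(h^2), and any other
  permutation picks at least two off-diagonal entries, each carrying a factor h.\<close>

lemma det_near_identity:
  fixes M :: real
  assumes "M \<ge> 0"
  shows "\<exists>C. \<forall>(A::real^'n^'n) h. (\<forall>i j. \<bar>A $ i $ j\<bar> \<le> M) \<longrightarrow> \<bar>h\<bar> \<le> 1 \<longrightarrow>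
    \<bar>det (mat 1 + h *\<^sub>R A) - 1 - h * (\<Sum>i\<in>UNIV. A $ i $ i)\<bar> \<le> C * h\<^sup>2"
proof -
  let ?P = "{p. p permutes (UNIV::'n set)}"
  \<comment> \<open>Naming the bound for a single permutation lets a constant be chosen for each p;
    their sum is the final constant.\<close>
  define Q where "Q p C \<longleftrightarrow> (\<forall>(A::real^'n^'n) h. (\<forall>i j. \<bar>A $ i $ j\<bar> \<le> M) \<longrightarrow> \<bar>h\<bar> \<le> 1 \<longrightarrow>
    \<bar>of_int (sign p) * (\<Prod>i\<in>UNIV. (mat 1 + h *\<^sub>R A) $ i $ p i)
      - (if p = id then 1 + h * (\<Sum>i\<in>UNIV. A $ i $ i) else 0)\<bar> \<le> C * h\<^sup>2)" for p C
  have "\<exists>C. Q p C" if p: "p \<in> ?P" for p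
  proof (cases "p = id")
    case True
    obtain C where "\<And>a h. (\<forall>i\<in>UNIV. \<bar>a (i::'n)\<bar> \<le> M) \<Longrightarrow> \<bar>h\<bar> \<le> 1 \<Longrightarrow>
      \<bar>(\<Prod>i\<in>UNIV. 1 + h * a i) - 1 - h * (\<Sum>i\<in>UNIV. a i)\<bar> \<le> C * h\<^sup>2"
      using prod_one_plus_expansion[of "UNIV::'n set" M] assms by auto
    then show ?thesis using True unfolding Q_def
      by (intro exI[of _ C]) (auto simp: mat_def diff_diff_eq)
  next
    case False
    then obtain i where i: "p i \<noteq> i" by (auto simp: fun_eq_iff)
    \<comment> \<open>The second moved index: injectivity turns \<open>p i \<noteq> i\<close> into
      \<open>p (p i) \<noteq> p i\<close>.\<close>
    define j where "j = p i"
    have j: "p j \<noteq> j" "j \<noteq> i" using i p unfolding j_def by (auto dest: permutes_inj injD)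
    show ?thesis unfolding Q_def
    \<comment> \<open>The two off-diagonal factors are at most |h| M, each remaining one at most 1 +
      M.\<close>
    proof (intro exI[of _ "M\<^sup>2 * (1 + M) ^ card (UNIV - {i, j})"] allI impI)
      fix A :: "real^'n^'n" and h :: real assume A: "\<forall>i j. \<bar>A $ i $ j\<bar> \<le> M" and h: "\<bar>h\<bar> \<le> 1"
      let ?B = "mat 1 + h *\<^sub>R A"
      have hA: "\<bar>h * A $ k $ l\<bar> \<le> M" for k l
        unfolding abs_mult using mult_mono[OF h, of "\<bar>A $ k $ l\<bar>" M] A by simp
      have "(\<Prod>k\<in>UNIV. ?B $ k $ p k) = (?B $ i $ p i) * ((?B $ j $ p j) * (\<Prod>k\<in>UNIV - {i, j}. ?B $ k $ p k))"
        using j(2) prod.remove[of UNIV i "\<lambda>k. ?B $ k $ p k"] prod.remove[of "UNIV - {i}" j "\<lambda>k. ?B $ k $ p k"]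
        by (simp add: Diff_insert2[symmetric] insert_commute)
      also have "\<bar>\<dots>\<bar> = h\<^sup>2 * (\<bar>A $ i $ p i\<bar> * (\<bar>A $ j $ p j\<bar> * (\<Prod>k\<in>UNIV - {i, j}. \<bar>?B $ k $ p k\<bar>)))"
        using i j by (simp add: mat_def abs_mult abs_prod power2_eq_square)
      also have "\<dots> \<le> h\<^sup>2 * (M * (M * (\<Prod>k\<in>UNIV - {i, j}. 1 + M)))"
      proof (intro mult_left_mono mult_mono prod_mono conjI)
        fix k show "\<bar>?B $ k $ p k\<bar> \<le> 1 + M"
          using hA[of k "p k"] by (auto simp: mat_def)
      qed (use A assms in \<open>auto intro!: prod_nonneg mult_nonneg_nonneg\<close>)
      finally show "\<bar>of_int (sign p) * (\<Prod>i\<in>UNIV. ?B $ i $ p i)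
        - (if p = id then 1 + h * (\<Sum>i\<in>UNIV. A $ i $ i) else 0)\<bar>
        \<le> M\<^sup>2 * (1 + M) ^ card (UNIV - {i, j}) * h\<^sup>2"
        using False by (simp add: abs_mult power2_eq_square mult_ac sign_def)
    qed
  qed
  then obtain C where "\<And>p. p \<in> ?P \<Longrightarrow> Q p (C p)" by metis
  then have C: "\<bar>of_int (sign p) * (\<Prod>i\<in>UNIV. (mat 1 + h *\<^sub>R A) $ i $ p i)
      - (if p = id then 1 + h * (\<Sum>i\<in>UNIV. A $ i $ i) else 0)\<bar> \<le> C p * h\<^sup>2"
    if "p \<in> ?P" "\<forall>i j. \<bar>(A::real^'n^'n) $ i $ j\<bar> \<le> M" "\<bar>h\<bar> \<le> 1" for p A h
    using that unfolding Q_def by blast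
  show ?thesis
  proof (intro exI[of _ "\<Sum>p\<in>?P. C p"] allI impI)
    fix A :: "real^'n^'n" and h :: real assume A: "\<forall>i j. \<bar>A $ i $ j\<bar> \<le> M" and h: "\<bar>h\<bar> \<le> 1"
    let ?t = "1 + h * (\<Sum>i\<in>UNIV. A $ i $ i)"
    have "?t = (\<Sum>p\<in>?P. if p = id then ?t else 0)" by (simp add: permutes_id)
    then have "det (mat 1 + h *\<^sub>R A) - ?t = (\<Sum>p\<in>?P. of_int (sign p) * (\<Prod>i\<in>UNIV. (mat 1 + h *\<^sub>R A) $ i $ p i)
      - (if p = id then ?t else 0))" unfolding det_def by (simp only: sum_subtractf)
    also have "\<bar>\<dots>\<bar> \<le> (\<Sum>p\<in>?P. C p * h\<^sup>2)"
      by (rule order_trans[OF sum_abs sum_mono]) (rule C[OF _ A h])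
    finally show "\<bar>det (mat 1 + h *\<^sub>R A) - 1 - h * (\<Sum>i\<in>UNIV. A $ i $ i)\<bar> \<le> (\<Sum>p\<in>?P. C p) * h\<^sup>2"
      by (simp add: sum_distrib_right diff_diff_eq)
  qed
qed

text \<open>Turns closeness to the domain into membership in a dilated copy. The preimage of y is
  the convex combination of z, with weight 1 / (1 + t), and of a + (y - z) / t, which lies in the
  ball because |y - z| \<le> t r.\<close>

lemma convex_dilation:
  fixes a :: "'a::euclidean_space"
  assumes \<Omega>: "convex \<Omega>" "cball a r \<subseteq> \<Omega>" and t: "t > 0" and z: "z \<in> \<Omega>" "dist y z \<le> t * r"
  shows "y \<in> (\<lambda>x. a + (1 + t) *\<^sub>R (x - a)) ` \<Omega>"
proof
  let ?x = "a + (1 / (1 + t)) *\<^sub>R (y - a)"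
  show "y = a + (1 + t) *\<^sub>R (?x - a)" using t by simp
  have "norm (y - z) / t \<le> r" using z(2) t by (simp add: dist_norm divide_le_eq mult.commute)
  then have "a + (1 / t) *\<^sub>R (y - z) \<in> cball a r" using t by (simp add: dist_norm)
  then have w: "a + (1 / t) *\<^sub>R (y - z) \<in> \<Omega>" using \<Omega>(2) by blast
  have "(1 / (1 + t)) *\<^sub>R z + (t / (1 + t)) *\<^sub>R (a + (1 / t) *\<^sub>R (y - z)) \<in> \<Omega>"
    using t by (intro convexD[OF \<Omega>(1) z(1) w]) (auto simp: field_simps)
  also have "(1 / (1 + t)) *\<^sub>R z + (t / (1 + t)) *\<^sub>R (a + (1 / t) *\<^sub>R (y - z))
      = (t / (1 + t)) *\<^sub>R a + (1 / (1 + t)) *\<^sub>R y"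
    using t by (simp add: algebra_simps)
  also have "t / (1 + t) = 1 - 1 / (1 + t)" using t by (simp add: field_simps)
  finally show "?x \<in> \<Omega>" by (simp add: algebra_simps)
qed

section \<open>Volume comparison under the map x + h X(x)\<close>

lemma set_integrable_continuous_bounded:
  fixes F :: "'a::euclidean_space \<Rightarrow> real"
  assumes "open \<Omega>" "bounded \<Omega>" "continuous_on UNIV F"
  shows "set_integrable lborel \<Omega> F"
proof (rule set_integrable_subset)
  show "set_integrable lborel (closure \<Omega>) F"
    unfolding set_integrable_def
    using assms by (intro borel_integrable_compact) (auto intro: continuous_on_subset)
qed (use assms closure_subset in auto)

lemma sum_Basis_vec: "(\<Sum>b\<in>Basis. f (b :: real^'n)) = (\<Sum>i\<in>UNIV. f (axis i 1))"
proof -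
  have B: "(Basis::(real^'n) set) = range (\<lambda>i. axis i 1)" by (auto simp: Basis_vec_def)
  have inj: "inj (\<lambda>i::'n. axis i (1::real))" by (simp add: inj_on_def axis_eq_axis)
  show ?thesis unfolding B sum.reindex[OF inj] by simp
qed

text \<open>For T(x) = x + h X(x) the integral of |det DT| is the volume of the image, at most (1 +
  e h / r)^n times that of the domain. Expanding det DT to first order and dividing by h bounds the
  divergence integral. First h tends to 0 for fixed e, and only then e tends to 0.\<close>

lemma integral_divergence_nonpos_wellorder:
  fixes X :: "real^'n::{finite,wellorder} \<Rightarrow> real^'n::_"
  assumes \<Omega>: "open \<Omega>" "bounded \<Omega>" "convex \<Omega>" "\<Omega> \<noteq> {}"
    and X: "\<And>x. (X has_derivative X' x) (at x)"
    and X': "\<And>b c. b \<in> Basis \<Longrightarrow> c \<in> Basis \<Longrightarrow> continuous_on UNIV (\<lambda>x. X' x b \<bullet> c)"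
    and flow: "\<And>e. e > 0 \<Longrightarrow> \<exists>\<delta>>0. \<forall>h x. 0 < h \<longrightarrow> h < \<delta> \<longrightarrow> x \<in> \<Omega> \<longrightarrow> (\<exists>z\<in>\<Omega>. dist (x + h *\<^sub>R X x) z \<le> e * h)"
  shows "(LINT x:\<Omega>|lborel. \<Sum>b\<in>Basis. X' x b \<bullet> b) \<le> 0"
proof -
  let ?n = "CARD('n)" and ?vol = "measure lebesgue \<Omega>"
  let ?D = "\<lambda>x. \<Sum>b\<in>Basis. X' x b \<bullet> b"
  obtain a r where a: "r > 0" "cball a r \<subseteq> \<Omega>" using \<Omega>(1,4) open_contains_cball by blast
  define Q where "Q b c M \<longleftrightarrow> (\<forall>x\<in>\<Omega>. \<bar>X' x b \<bullet> c\<bar> \<le> M)" for b c M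
  have "\<exists>M. Q b c M" if "b \<in> Basis" "c \<in> Basis" for b c
  proof -
    have "compact ((\<lambda>x. X' x b \<bullet> c) ` closure \<Omega>)"
      using \<Omega>(2) X'[OF that] by (intro compact_continuous_image) (auto intro: continuous_on_subset)
    then have "bounded ((\<lambda>x. X' x b \<bullet> c) ` closure \<Omega>)" by (rule compact_imp_bounded)
    then show ?thesis using closure_subset[of \<Omega>] unfolding bounded_iff Q_def by auto
  qed
  then obtain M0 where "\<And>b c. b \<in> Basis \<Longrightarrow> c \<in> Basis \<Longrightarrow> Q b c (M0 b c)" by metis
  then have M0: "\<bar>X' x b \<bullet> c\<bar> \<le> M0 b c" if "b \<in> Basis" "c \<in> Basis" "x \<in> \<Omega>" for b c x
    using that unfolding Q_def by blast
  define M where "M = (\<Sum>b\<in>Basis. \<Sum>c\<in>Basis. \<bar>M0 b c\<bar>)"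
  have M: "\<bar>X' x b \<bullet> c\<bar> \<le> M" if "b \<in> Basis" "c \<in> Basis" "x \<in> \<Omega>" for b c x
  proof -
    have "\<bar>X' x b \<bullet> c\<bar> \<le> \<bar>M0 b c\<bar>" using M0[OF that] by simp
    also have "\<dots> \<le> (\<Sum>c\<in>Basis. \<bar>M0 b c\<bar>)" using that by (intro member_le_sum) auto
    also have "\<dots> \<le> M" unfolding M_def using that by (intro member_le_sum) (auto intro: sum_nonneg)
    finally show ?thesis .
  qed
  have M_nonneg: "M \<ge> 0" by (auto simp: M_def intro!: sum_nonneg)
  \<comment> \<open>Crude Lipschitz constant: the derivative sends each of the n basis vectors to a
    vector of norm at most n M.\<close>
  define L where "L = ?n * (?n * M)"
  have lip: "norm (X x - X y) \<le> L * norm (x - y)" if "x \<in> \<Omega>" "y \<in> \<Omega>" for x y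
  proof (rule differentiable_bound[OF \<Omega>(3) _ _ that])
    fix x assume x: "x \<in> \<Omega>"
    show "(X has_derivative X' x) (at x within \<Omega>)" using X has_derivative_at_withinI by blast
    interpret linear "X' x" using X has_derivative_linear by blast
    show "onorm (X' x) \<le> L"
    proof (rule onorm_le)
      fix h
      have "X' x h = (\<Sum>b\<in>Basis. (h \<bullet> b) *\<^sub>R X' x b)"
        by (subst euclidean_representation[of h, symmetric]) (simp only: sum scale)
      then have "norm (X' x h) \<le> (\<Sum>b\<in>Basis. norm ((h \<bullet> b) *\<^sub>R X' x b))" by (simp only: norm_sum)
      also have "\<dots> \<le> (\<Sum>b\<in>(Basis::(real^'n::_) set). norm h * (?n * M))"
      proof (rule sum_mono)
        fix b :: "real^'n::_" assume b: "b \<in> Basis"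
        have "norm (X' x b) \<le> (\<Sum>c\<in>Basis. \<bar>X' x b \<bullet> c\<bar>)" by (rule norm_le_l1)
        also have "\<dots> \<le> (\<Sum>c\<in>(Basis::(real^'n::_) set). M)" using M[OF b _ x] by (intro sum_mono) auto
        finally have "norm (X' x b) \<le> ?n * M" by simp
        then show "norm ((h \<bullet> b) *\<^sub>R X' x b) \<le> norm h * (?n * M)"
          using Basis_le_norm[OF b, of h] by (simp add: mult_mono)
      qed
      also have "\<dots> = L * norm h" by (simp add: L_def)
      finally show "norm (X' x h) \<le> L * norm h" .
    qed
  qed
  have L: "L \<ge> 0" using M_nonneg by (simp add: L_def)
  obtain C where C: "\<And>(A::real^'n::_^'n::_) h. (\<forall>i j. \<bar>A $ i $ j\<bar> \<le> M) \<Longrightarrow> \<bar>h\<bar> \<le> 1 \<Longrightarrow>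
    \<bar>det (mat 1 + h *\<^sub>R A) - 1 - h * (\<Sum>i\<in>UNIV. A $ i $ i)\<bar> \<le> C * h\<^sup>2"
    using det_near_identity[OF M_nonneg] by blast
  have contD: "continuous_on UNIV ?D" using X' by (intro continuous_on_sum) auto
  have intD: "set_integrable lborel \<Omega> ?D"
    by (rule set_integrable_continuous_bounded[OF \<Omega>(1,2) contD])
  have D_int: "?D integrable_on \<Omega>" "(LINT x:\<Omega>|lborel. ?D x) = integral \<Omega> ?D"
    using set_borel_integral_eq_integral[OF intD] by auto
  have \<Omega>m: "\<Omega> \<in> lmeasurable" using \<Omega> by (simp add: lmeasurable_open)
  have trace: "(\<Sum>i\<in>UNIV. matrix (X' x) $ i $ i) = ?D x" for x
  proof -
    have "?D x = (\<Sum>i\<in>UNIV. X' x (axis i 1) \<bullet> axis i 1)" by (rule sum_Basis_vec)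
    then show ?thesis by (simp add: matrix_def inner_axis)
  qed
  have entry: "matrix (X' x) $ i $ j = X' x (axis j 1) \<bullet> axis i 1" for x i j
    by (simp add: matrix_def inner_axis)
  have main: "integral \<Omega> ?D \<le> ?vol * (((1 + e / r * h) ^ ?n - 1) / h + C * h)"
    if h: "0 < h" "h < 1" "h * L < 1" and e: "e > 0"
      and close: "\<And>x. x \<in> \<Omega> \<Longrightarrow> \<exists>z\<in>\<Omega>. dist (x + h *\<^sub>R X x) z \<le> e * h" for h e
  proof -
    let ?T = "\<lambda>x. x + h *\<^sub>R X x" and ?T' = "\<lambda>x v. v + h *\<^sub>R X' x v"
    \<comment> \<open>The dilation of \<open>convex_dilation\<close> with t = e h / r, so that t r
      is the allowed distance e h.\<close>
    let ?S = "\<lambda>x. a + (1 + e / r * h) *\<^sub>R (x - a)"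
    have dT: "(?T has_derivative ?T' x) (at x within \<Omega>)" for x
      using has_derivative_at_withinI[OF X] by (auto intro!: derivative_eq_intros)
    \<comment> \<open>A perturbation of the identity by a map with Lipschitz constant h L < 1 is
      injective.\<close>
    have inj: "inj_on ?T \<Omega>"
    proof (rule inj_onI)
      fix x y assume xy: "x \<in> \<Omega>" "y \<in> \<Omega>" "?T x = ?T y"
      then have "x - y = h *\<^sub>R (X y - X x)" by (simp add: algebra_simps)
      then have "norm (x - y) = h * norm (X x - X y)" using h(1) by (simp add: norm_minus_commute)
      also have "\<dots> \<le> h * (L * norm (x - y))" using lip[OF xy(1,2)] h(1) by (simp add: mult_left_mono)
      finally have "(1 - h * L) * norm (x - y) \<le> 0" by (simp add: algebra_simps)
      then show "x = y" using h(3) by (simp add: mult_le_0_iff)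
    qed
    have sub: "?T ` \<Omega> \<subseteq> ?S ` \<Omega>"
    proof
      fix y assume "y \<in> ?T ` \<Omega>"
      then obtain x where x: "x \<in> \<Omega>" "y = ?T x" by blast
      obtain z where "z \<in> \<Omega>" "dist (?T x) z \<le> e * h" using close[OF x(1)] by blast
      then show "y \<in> ?S ` \<Omega>"
        unfolding x(2) using a e h(1) by (intro convex_dilation[OF \<Omega>(3) a(2)]) auto
    qed
    have S_eq: "?S = (\<lambda>x. (1 + e / r * h) *\<^sub>R x + (a - (1 + e / r * h) *\<^sub>R a))"
      by (auto simp: algebra_simps)
    have S_meas: "measure lebesgue (?S ` \<Omega>) = (1 + e / r * h) ^ ?n * ?vol"
      unfolding S_eq measure_lebesgue_affine using a(1) e h(1) by simp
    have bS: "bounded (?S ` \<Omega>)"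
      unfolding S_eq
      using bounded_translation[OF bounded_scaling[OF \<Omega>(2)], of "a - (1 + e / r * h) *\<^sub>R a" "1 + e / r * h"]
      by (simp add: image_image add.commute)
    have contT: "continuous_on \<Omega> ?T"
      by (rule has_derivative_continuous_on[OF dT])
    have oT: "open (?T ` \<Omega>)" by (rule invariance_of_domain[OF contT \<Omega>(1) inj])
    have oS: "open (?S ` \<Omega>)"
    proof (rule invariance_of_domain[OF _ \<Omega>(1)])
      have "1 + e / r * h \<noteq> 0" using a(1) e h(1) by (smt (verit) divide_pos_pos mult_pos_pos)
      then show "inj_on ?S \<Omega>" by (auto intro: inj_onI)
    qed (intro continuous_intros)
    have Tm: "?T ` \<Omega> \<in> lmeasurable" using oT bS sub by (auto intro: lmeasurable_open bounded_subset)
    have Sm: "?S ` \<Omega> \<in> lmeasurable" using oS bS by (auto intro: lmeasurable_open)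
    have le: "measure lebesgue (?T ` \<Omega>) \<le> (1 + e / r * h) ^ ?n * ?vol"
      unfolding S_meas[symmetric] using sub Tm Sm by (intro measure_mono_fmeasurable) auto
    have det_int: "((\<lambda>x. \<bar>det (matrix (?T' x))\<bar>) has_integral measure lebesgue (?T ` \<Omega>)) \<Omega>"
      using has_measure_differentiable_image[OF _ dT inj] Tm \<Omega>m by (auto dest: fmeasurableD)
    have one: "((\<lambda>x. 1) has_integral ?vol) \<Omega>"
      unfolding has_integral_iff using lmeasurable_iff_integrable_on lmeasure_integral \<Omega>m by metis
    have "((\<lambda>x. 1 + h * ?D x - C * h\<^sup>2) has_integral (?vol + h * integral \<Omega> ?D - ?vol * (C * h\<^sup>2))) \<Omega>"
      using has_integral_mult_left[OF one, of "C * h\<^sup>2"]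
      by (intro has_integral_diff has_integral_add one has_integral_mult_right integrable_integral D_int(1))
         simp
    then have "?vol + h * integral \<Omega> ?D - ?vol * (C * h\<^sup>2) \<le> measure lebesgue (?T ` \<Omega>)"
    proof (rule has_integral_le[OF _ det_int])
      fix x assume x: "x \<in> \<Omega>"
      have mat: "matrix (?T' x) = mat 1 + h *\<^sub>R matrix (X' x)"
        by (auto simp: matrix_def mat_def vec_eq_iff axis_def)
      have "\<forall>i j. \<bar>matrix (X' x) $ i $ j\<bar> \<le> M"
        unfolding entry using M[OF _ _ x] by (simp add: axis_in_Basis_iff)
      from C[OF this, of h] show "1 + h * ?D x - C * h\<^sup>2 \<le> \<bar>det (matrix (?T' x))\<bar>"
        unfolding mat trace using h by simp
    qed
    then have "h * integral \<Omega> ?D \<le> ((1 + e / r * h) ^ ?n - 1) * ?vol + ?vol * (C * h\<^sup>2)"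
      using le by (simp add: algebra_simps)
    then have "integral \<Omega> ?D \<le> (((1 + e / r * h) ^ ?n - 1) * ?vol + ?vol * (C * h\<^sup>2)) / h"
      using h(1) by (simp add: pos_le_divide_eq mult.commute)
    also have "\<dots> = ?vol * (((1 + e / r * h) ^ ?n - 1) / h + C * h)"
      using h(1) by (simp add: field_simps power2_eq_square)
    finally show ?thesis .
  qed
  \<comment> \<open>(1 + (e / r) h)^n has derivative n e / r at h = 0, and the term C h vanishes in
    the limit.\<close>
  have bound: "integral \<Omega> ?D \<le> ?vol * (?n * (e / r))" if e: "e > 0" for e
  proof (rule tendsto_lowerbound)
    have "((\<lambda>h. (1 + e / r * h) ^ ?n) has_real_derivative ?n * (e / r)) (at 0)"
      using a(1) by (auto intro!: derivative_eq_intros)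
    then have "((\<lambda>h. ((1 + e / r * h) ^ ?n - 1) / h) \<longlongrightarrow> ?n * (e / r)) (at 0)"
      unfolding DERIV_def by simp
    then have "((\<lambda>h. ((1 + e / r * h) ^ ?n - 1) / h) \<longlongrightarrow> ?n * (e / r)) (at_right 0)"
      by (rule tendsto_mono[rotated]) (simp add: at_le)
    then have "((\<lambda>h. ?vol * (((1 + e / r * h) ^ ?n - 1) / h + C * h)) \<longlongrightarrow> ?vol * (?n * (e / r) + C * 0)) (at_right 0)"
      by (intro tendsto_intros)
    then show "((\<lambda>h. ?vol * (((1 + e / r * h) ^ ?n - 1) / h + C * h)) \<longlongrightarrow> ?vol * (?n * (e / r))) (at_right 0)"
      by simp
    obtain \<delta> where \<delta>: "\<delta> > 0" "\<And>h x. 0 < h \<Longrightarrow> h < \<delta> \<Longrightarrow> x \<in> \<Omega> \<Longrightarrow> \<exists>z\<in>\<Omega>. dist (x + h *\<^sub>R X x) z \<le> e * h"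
      using flow[OF e] by blast
    show "\<forall>\<^sub>F h in at_right 0. integral \<Omega> ?D \<le> ?vol * (((1 + e / r * h) ^ ?n - 1) / h + C * h)"
      unfolding eventually_at_right_field
    \<comment> \<open>The bound 1 / (L + 1) secures h L < 1 and makes sense also for L = 0.\<close>
    proof (intro exI[of _ "min \<delta> (min 1 (1 / (L + 1)))"] conjI allI impI)
      show "0 < min \<delta> (min 1 (1 / (L + 1)))" using \<delta> L by simp
      fix h assume h: "0 < h" "h < min \<delta> (min 1 (1 / (L + 1)))"
      then have "h * (L + 1) < 1" using L by (simp add: pos_less_divide_eq)
      then have "h * L < 1" using h by (simp add: algebra_simps)
      then show "integral \<Omega> ?D \<le> ?vol * (((1 + e / r * h) ^ ?n - 1) / h + C * h)"
        using h \<delta>(2) e by (intro main) auto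
    qed
  qed simp
  have "integral \<Omega> ?D \<le> 0"
  proof (rule tendsto_lowerbound)
    have "((\<lambda>e. ?vol * (?n * (e / r))) \<longlongrightarrow> ?vol * (?n * (0 / r))) (at_right 0)"
      by (intro tendsto_intros) (use a(1) in simp)
    then show "((\<lambda>e. ?vol * (?n * (e / r))) \<longlongrightarrow> 0) (at_right 0)" by simp
    show "\<forall>\<^sub>F e in at_right 0. integral \<Omega> ?D \<le> ?vol * (?n * (e / r))"
      unfolding eventually_at_right_field by (intro exI[of _ 1]) (use bound in auto)
  qed simp
  then show ?thesis using D_int(2) by simp
qed

section \<open>Transport to a well-ordered copy of the index type\<close>

lemma lborel_distr_Basis_bij:
  fixes J :: "'a::euclidean_space \<Rightarrow> 'b::euclidean_space"
  assumes J: "linear J" "bij_betw J Basis Basis"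
  shows "distr lborel borel J = lborel"
proof (rule lborel_eqI[symmetric])
  interpret J: linear J by (rule J)
  have [measurable]: "J \<in> borel_measurable borel"
    using J(1) linear_continuous_on linear_conv_bounded_linear borel_measurable_continuous_onI by blast
  \<comment> \<open>J permutes orthonormal bases, so the coordinate of J x along J b is that of x
    along b; preimages of boxes are therefore boxes with the same side lengths.\<close>
  have inner: "J x \<bullet> J b = x \<bullet> b" if b: "b \<in> Basis" for x b
  proof -
    have "J x \<bullet> J b = (\<Sum>c\<in>Basis. (x \<bullet> c) * (J c \<bullet> J b))"
      by (subst euclidean_representation[of x, symmetric])
         (simp only: J.sum J.scale inner_sum_left inner_scaleR_left)
    also have "\<dots> = (\<Sum>c\<in>Basis. if c = b then x \<bullet> b else 0)"
    proof (rule sum.cong)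
      fix c assume c: "c \<in> (Basis :: 'a set)"
      have "J c \<in> Basis" "J b \<in> Basis" using bij_betwE[OF J(2)] b c by blast+
      moreover have "J c = J b \<longleftrightarrow> c = b" using J(2) b c unfolding bij_betw_def by (blast dest: inj_onD)
      ultimately show "(x \<bullet> c) * (J c \<bullet> J b) = (if c = b then x \<bullet> b else 0)"
        by (simp add: inner_Basis)
    qed simp
    finally show ?thesis using b by simp
  qed
  have Basis_eq: "Basis = J ` Basis" using J(2) by (simp add: bij_betw_def)
  fix l u :: 'b assume le: "\<And>b. b \<in> Basis \<Longrightarrow> l \<bullet> b \<le> u \<bullet> b"
  let ?K = "\<lambda>y. \<Sum>b\<in>Basis. (y \<bullet> J b) *\<^sub>R b"
  have "J -` box l u = box (?K l) (?K u)"
    unfolding box_def Basis_eq by (auto simp: inner)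
  then have "emeasure (distr lborel borel J) (box l u) = emeasure lborel (box (?K l) (?K u))"
    by (simp add: emeasure_distr)
  also have "\<dots> = (\<Prod>b\<in>Basis. (u - l) \<bullet> J b)"
    using le J(2) by (subst emeasure_lborel_box) (auto simp: inner_diff_left bij_betw_def)
  also have "\<dots> = (\<Prod>b\<in>Basis. (u - l) \<bullet> b)"
    using prod.reindex_bij_betw[OF J(2)] by metis
  finally show "emeasure (distr lborel borel J) (box l u) = (\<Prod>b\<in>Basis. (u - l) \<bullet> b)" .
qed simp

typedef 'a index = "UNIV :: 'a set" by simp

instance index :: (finite) finite
proof
  have "(UNIV :: 'a index set) = Abs_index ` UNIV"
    using type_definition.Abs_image[OF type_definition_index] by metis
  then show "finite (UNIV :: 'a index set)" by (metis finite finite_imageI)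
qed

definition index_rank :: "'a::finite index \<Rightarrow> nat"
  where "index_rank = (SOME f. inj f)"

lemma inj_index_rank: "inj (index_rank :: 'a::finite index \<Rightarrow> nat)"
  unfolding index_rank_def
  using finite_imp_inj_to_nat_seg[of "UNIV :: 'a index set"] by (intro someI_ex[of inj]) auto

instantiation index :: (finite) wellorder
begin

definition "i \<le> j \<longleftrightarrow> index_rank i \<le> index_rank j" for i j :: "'a index"
definition "i < j \<longleftrightarrow> index_rank i < index_rank j" for i j :: "'a index"

instance
proof
  fix P :: "'a index \<Rightarrow> bool" and a
  assume step: "\<And>x. (\<And>y. y < x \<Longrightarrow> P y) \<Longrightarrow> P x"
  show "P a"
  proof (rule measure_induct_rule[of index_rank P])
    fix x :: "'a index" assume IH: "\<And>y. index_rank y < index_rank x \<Longrightarrow> P y"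
    show "P x" by (rule step) (simp add: less_index_def IH)
  qed
next
  fix i j :: "'a index" assume "i \<le> j" "j \<le> i"
  then show "i = j" by (intro injD[OF inj_index_rank]) (simp add: less_eq_index_def)
qed (simp_all add: less_eq_index_def less_index_def less_le_not_le linear)

end

text \<open>The change of variables theorems of the library require a well-ordered index type. They
  are applied on the copy \<open>real ^ 'n index\<close> of the space and transported by the coordinate
  isomorphism.\<close>

lemma integral_divergence_nonpos_flow:
  fixes X :: "real^'n \<Rightarrow> real^'n"
  assumes \<Omega>: "open \<Omega>" "bounded \<Omega>" "convex \<Omega>" "\<Omega> \<noteq> {}"
    and X: "\<And>x. (X has_derivative X' x) (at x)"
    and X': "\<And>b c. b \<in> Basis \<Longrightarrow> c \<in> Basis \<Longrightarrow> continuous_on UNIV (\<lambda>x. X' x b \<bullet> c)"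
    and flow: "\<And>e. e > 0 \<Longrightarrow> \<exists>\<delta>>0. \<forall>h x. 0 < h \<longrightarrow> h < \<delta> \<longrightarrow> x \<in> \<Omega> \<longrightarrow> (\<exists>z\<in>\<Omega>. dist (x + h *\<^sub>R X x) z \<le> e * h)"
  shows "(LINT x:\<Omega>|lborel. \<Sum>b\<in>Basis. X' x b \<bullet> b) \<le> 0"
proof -
  define J :: "real ^ 'n index \<Rightarrow> real ^ 'n" where "J y = (\<chi> i. y $ Abs_index i)" for y
  define K :: "real ^ 'n \<Rightarrow> real ^ 'n index" where "K x = (\<chi> i. x $ Rep_index i)" for x
  have JK [simp]: "J (K x) = x" "K (J y) = y" for x y
    by (simp_all add: J_def K_def vec_eq_iff Abs_index_inverse Rep_index_inverse)
  have lin: "linear J" "linear K" by (auto intro!: linearI simp: J_def K_def vec_eq_iff)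
  interpret J: linear J by (rule lin)
  interpret K: linear K by (rule lin)
  have blin: "bounded_linear J" "bounded_linear K"
    using lin linear_conv_bounded_linear by blast+
  have axis: "J (axis i 1) = axis (Rep_index i) 1" for i
    by (auto simp: J_def axis_def vec_eq_iff Abs_index_inverse Rep_index_inverse)
  have Basis_vec: "(Basis :: (real^'m) set) = range (\<lambda>i. axis i 1)" by (auto simp: Basis_vec_def)
  have surj: "range (Rep_index :: 'n index \<Rightarrow> 'n) = UNIV"
    using type_definition.Rep_range[OF type_definition_index] .
  have "J ` range (\<lambda>i. axis i 1) = (\<lambda>i. axis i 1) ` range Rep_index"
    by (simp add: image_image axis)
  then have JB: "J ` Basis = Basis" unfolding Basis_vec surj .
  have injJ: "inj J" using JK(2) by (metis injI)
  then have bij: "bij_betw J Basis Basis"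
    unfolding bij_betw_def using JB inj_on_subset by blast
  \<comment> \<open>K is the adjoint of J. This yields both that K is an isometry and that the
    conjugated field has the same divergence.\<close>
  have inner_K: "K x \<bullet> b = x \<bullet> J b" for x b
    unfolding inner_vec_def J_def K_def
    by (rule sum.reindex_bij_witness[of _ Abs_index Rep_index])
       (auto simp: Abs_index_inverse Rep_index_inverse)
  have norm_K: "norm (K x) = norm x" for x
    by (simp add: norm_eq_sqrt_inner inner_K)
  have dist_K: "dist (K x) (K y) = dist x y" for x y
    by (simp add: dist_norm norm_K flip: K.diff)
  let ?\<Omega> = "K ` \<Omega>"
  have \<Omega>_eq: "?\<Omega> = J -` \<Omega>" by (auto simp: image_iff) (metis JK(2))
  let ?Y = "\<lambda>y. K (X (J y))" and ?Y' = "\<lambda>y v. K (X' (J y) (J v))"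
  have "(LINT y:?\<Omega>|lborel. \<Sum>b\<in>Basis. ?Y' y b \<bullet> b) \<le> 0"
  proof (rule integral_divergence_nonpos_wellorder)
    show "open ?\<Omega>" unfolding \<Omega>_eq
      using \<Omega>(1) blin(1) by (intro open_vimage linear_continuous_on)
    show "bounded ?\<Omega>" using \<Omega>(2) blin(2) by (rule bounded_linear_image)
    show "convex ?\<Omega>" using lin(2) \<Omega>(3) by (rule convex_linear_image)
    show "?\<Omega> \<noteq> {}" using \<Omega>(4) by simp
    show "(?Y has_derivative ?Y' y) (at y)" for y
      by (intro bounded_linear.has_derivative[OF blin(2)] has_derivative_compose[OF bounded_linear.has_derivative[OF blin(1) has_derivative_ident] X])
    show "continuous_on UNIV (\<lambda>y. ?Y' y b \<bullet> c)" if "b \<in> Basis" "c \<in> Basis" for b c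
      unfolding inner_K
      using X'[of "J b" "J c"] JB that
      by (intro continuous_on_compose2[OF _ linear_continuous_on[OF blin(1)], of UNIV]) auto
  next
    fix e :: real assume "e > 0"
    from flow[OF this] obtain \<delta> where \<delta>: "\<delta> > 0"
      "\<And>h x. 0 < h \<Longrightarrow> h < \<delta> \<Longrightarrow> x \<in> \<Omega> \<Longrightarrow> \<exists>z\<in>\<Omega>. dist (x + h *\<^sub>R X x) z \<le> e * h" by blast
    show "\<exists>\<delta>>0. \<forall>h y. 0 < h \<longrightarrow> h < \<delta> \<longrightarrow> y \<in> ?\<Omega> \<longrightarrow> (\<exists>z\<in>?\<Omega>. dist (y + h *\<^sub>R ?Y y) z \<le> e * h)"
    proof (intro exI[of _ \<delta>] conjI allI impI \<delta>)
      fix h y assume h: "0 < h" "h < \<delta>" and "y \<in> ?\<Omega>"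
      then obtain x where x: "x \<in> \<Omega>" "y = K x" by blast
      obtain z where z: "z \<in> \<Omega>" "dist (x + h *\<^sub>R X x) z \<le> e * h" using \<delta>(2)[OF h x(1)] by blast
      then have "dist (y + h *\<^sub>R ?Y y) (K z) \<le> e * h"
        using dist_K[of "x + h *\<^sub>R X x" z] by (simp add: x K.add K.scale)
      then show "\<exists>z\<in>?\<Omega>. dist (y + h *\<^sub>R ?Y y) z \<le> e * h" using z(1) by blast
    qed
  qed
  also have "(LINT y:?\<Omega>|lborel. \<Sum>b\<in>Basis. ?Y' y b \<bullet> b)
      = (LINT y|lborel. (\<lambda>x. indicator \<Omega> x *\<^sub>R (\<Sum>b\<in>Basis. X' x b \<bullet> b)) (J y))"
    unfolding set_lebesgue_integral_def inner_K sum.reindex_bij_betw[OF bij, of "\<lambda>b. X' (J _) b \<bullet> b"]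
    by (auto simp: \<Omega>_eq indicator_def intro!: Bochner_Integration.integral_cong)
  also have "\<dots> = (LINT x|distr lborel borel J. indicator \<Omega> x *\<^sub>R (\<Sum>b\<in>Basis. X' x b \<bullet> b))"
  proof (rule integral_distr[symmetric])
    show "J \<in> lborel \<rightarrow>\<^sub>M borel"
      using borel_measurable_continuous_onI[OF linear_continuous_on[OF blin(1)]] by simp
    have "continuous_on UNIV (\<lambda>x. \<Sum>b\<in>Basis. X' x b \<bullet> b)" by (intro continuous_on_sum X')
    then have "(\<lambda>x. \<Sum>b\<in>Basis. X' x b \<bullet> b) \<in> borel_measurable borel"
      by (rule borel_measurable_continuous_onI)
    then show "(\<lambda>x. indicator \<Omega> x *\<^sub>R (\<Sum>b\<in>Basis. X' x b \<bullet> b)) \<in> borel_measurable borel"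
      using \<Omega>(1) by (intro borel_measurable_scaleR borel_measurable_indicator) auto
  qed
  also have "\<dots> = (LINT x:\<Omega>|lborel. \<Sum>b\<in>Basis. X' x b \<bullet> b)"
    unfolding lborel_distr_Basis_bij[OF lin(1) bij] set_lebesgue_integral_def ..
  finally show ?thesis .
qed

text \<open>The form used for the energy relations: the field is given by its smooth components, and
  the boundary hypothesis says that it does not point outwards.\<close>

lemma integral_divergence_nonpos:
  fixes \<Omega> :: "(real^'n) set"
  assumes \<Omega>: "open \<Omega>" "\<Omega> \<noteq> {}" "bounded \<Omega>" "convex \<Omega>" "smooth_boundary \<Omega>"
    and W: "\<And>b. b \<in> Basis \<Longrightarrow> smooth (W b)"
    and inward: "\<And>p \<rho>. p \<in> frontier \<Omega> \<Longrightarrow> local_defining_function \<Omega> p \<rho> \<Longrightarrow>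
      (\<Sum>b\<in>Basis. W b p * partial b \<rho> p) \<le> 0"
  shows "(LINT x:\<Omega>|lborel. \<Sum>b\<in>Basis. partial b (W b) x) \<le> 0"
proof -
  define X where "X x = (\<Sum>b\<in>Basis. W b x *\<^sub>R b)" for x
  define X' where "X' x h = (\<Sum>b\<in>Basis. (grad (W b) x \<bullet> h) *\<^sub>R b)" for x h
  have X: "(X has_derivative X' x) (at x)" for x
    unfolding X_def X'_def
    using W by (intro has_derivative_sum has_derivative_scaleR_left has_derivative_grad smoothD)
  have X'b: "X' x b \<bullet> c = partial b (W c) x" if "b \<in> Basis" "c \<in> Basis" for x b c
    using that by (simp add: X'_def grad_inner_Basis)
  have "(LINT x:\<Omega>|lborel. \<Sum>b\<in>Basis. X' x b \<bullet> b) \<le> 0"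
  proof (rule integral_divergence_nonpos_flow[OF \<Omega>(1,3,4,2) X])
    show "continuous_on UNIV (\<lambda>x. X' x b \<bullet> c)" if "b \<in> Basis" "c \<in> Basis" for b c
      unfolding X'b[OF that] using W that by (intro smooth_continuous smooth_partial)
    fix e :: real assume e: "e > 0"
    show "\<exists>\<delta>>0. \<forall>h x. 0 < h \<longrightarrow> h < \<delta> \<longrightarrow> x \<in> \<Omega> \<longrightarrow> (\<exists>z\<in>\<Omega>. dist (x + h *\<^sub>R X x) z \<le> e * h)"
    proof (rule flow_stays_close[OF \<Omega>(1,3,5) _ _ e])
      show "continuous_on UNIV X"
        by (rule has_derivative_continuous_on[OF has_derivative_at_withinI[OF X]])
      show "grad \<rho> p \<bullet> X p \<le> 0" if "p \<in> frontier \<Omega>" "local_defining_function \<Omega> p \<rho>" for p \<rho>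
        using inward[OF that] by (simp add: grad_inner X_def)
    qed
  qed
  then show ?thesis by (simp add: X'b)
qed

section \<open>Energy identities for the Gaussian weight\<close>

lemma smooth_power2: "smooth u \<Longrightarrow> smooth (\<lambda>x. (u x)\<^sup>2)"
  unfolding power2_eq_square by (intro smooth_mult)

lemma smooth_norm_grad_square: "smooth u \<Longrightarrow> smooth (\<lambda>x. (norm (grad u x))\<^sup>2)"
  unfolding norm_grad_square by (intro smooth_sum smooth_power2 smooth_partial)

text \<open>Here f = j|x|^2, so the drift grad f is 2j x.\<close>

lemma weighted_laplacian_gaussian:
  fixes x :: "'a::euclidean_space"
  shows "weighted_laplacian (\<lambda>x. exp (- j * (norm x)\<^sup>2)) u x =
    - (\<Sum>b\<in>Basis. partial b (partial b u) x) + 2 * j * (\<Sum>b\<in>Basis. (x \<bullet> b) * partial b u x)"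
proof -
  have "((\<lambda>y. - ln (exp (- j * (norm y)\<^sup>2))) has_derivative (\<lambda>h. 2 * j * (x \<bullet> h))) (at x)"
    unfolding power2_norm_eq_inner
    by (auto intro!: derivative_eq_intros simp: inner_commute algebra_simps)
  from partial_eq[OF this]
  have "grad (\<lambda>y. - ln (exp (- j * (norm y)\<^sup>2))) x = (2 * j) *\<^sub>R x"
    unfolding grad_def by (simp add: scaleR_sum_right[symmetric] euclidean_representation flip: scaleR_scaleR)
  then show ?thesis
    unfolding weighted_laplacian_def laplacian_def
    by (simp add: inner_commute[of x "grad u x"] grad_inner)
qed

lemma smooth_weighted_laplacian_gaussian:
  assumes "smooth u"
  shows "smooth (weighted_laplacian (\<lambda>x. exp (- j * (norm x)\<^sup>2)) u)"
proof -
  have "smooth (\<lambda>x. - (\<Sum>b\<in>Basis. partial b (partial b u) x) +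
      2 * j * (\<Sum>b\<in>Basis. (x \<bullet> b) * partial b u x))"
    using assms
    by (intro smooth_add smooth_minus smooth_mult smooth_sum smooth_const smooth_inner smooth_partial)
  then show ?thesis unfolding weighted_laplacian_gaussian[abs_def] .
qed

text \<open>Besides L applied to \<open>partial b u\<close> (after reordering derivatives), the
  coefficient x contributes 2j \<open>partial b u\<close>. This is the Hessian of f at work, the
  source of the constant 2j.\<close>

lemma partial_weighted_laplacian_gaussian:
  fixes x :: "'a::euclidean_space"
  assumes u: "smooth u" and b: "b \<in> Basis"
  shows "partial b (weighted_laplacian (\<lambda>x. exp (- j * (norm x)\<^sup>2)) u) x =
    - (\<Sum>c\<in>Basis. partial b (partial c (partial c u)) x)
    + 2 * j * (partial b u x + (\<Sum>c\<in>Basis. (x \<bullet> c) * partial b (partial c u) x))"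
proof -
  have d: "partial c u differentiable at x" "partial c (partial c u) differentiable at x"
      "(\<lambda>x. x \<bullet> c) differentiable at x" if "c \<in> Basis" for c
    using u that smoothD smooth_partial smooth_inner by blast+
  have dm: "(\<lambda>x. (x \<bullet> c) * partial c u x) differentiable at x" if "c \<in> Basis" for c
    using d that by (intro differentiable_mult)
  have 1: "(\<lambda>x. - 1 * (\<Sum>c\<in>Basis. partial c (partial c u) x)) differentiable at x"
    "(\<lambda>x. \<Sum>c\<in>Basis. partial c (partial c u) x) differentiable at x"
    "(\<lambda>x. 2 * j * (\<Sum>c\<in>Basis. (x \<bullet> c) * partial c u x)) differentiable at x"
    "(\<lambda>x. \<Sum>c\<in>Basis. (x \<bullet> c) * partial c u x) differentiable at x"
    using d dm by (auto intro!: differentiable_mult differentiable_sum differentiable_const)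
  have s1: "partial b (\<lambda>x. \<Sum>c\<in>Basis. partial c (partial c u) x) x
      = (\<Sum>c\<in>Basis. partial b (partial c (partial c u)) x)"
    by (rule partial_sum) (rule d(2))
  have "partial b (\<lambda>x. \<Sum>c\<in>Basis. (x \<bullet> c) * partial c u x) x
      = (\<Sum>c\<in>Basis. partial b (\<lambda>x. (x \<bullet> c) * partial c u x) x)"
    by (rule partial_sum) (rule dm)
  also have "\<dots> = (\<Sum>c\<in>Basis. (b \<bullet> c) * partial c u x + (x \<bullet> c) * partial b (partial c u) x)"
    by (intro sum.cong refl) (simp only: partial_mult[OF d(3,1)] partial_inner)
  finally have s2: "partial b (\<lambda>x. \<Sum>c\<in>Basis. (x \<bullet> c) * partial c u x) x
      = (\<Sum>c\<in>Basis. (b \<bullet> c) * partial c u x + (x \<bullet> c) * partial b (partial c u) x)" .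
  have e: "weighted_laplacian (\<lambda>x. exp (- j * (norm x)\<^sup>2)) u = (\<lambda>x. (- 1) * (\<Sum>b\<in>Basis. partial b (partial b u) x) +
      2 * j * (\<Sum>b\<in>Basis. (x \<bullet> b) * partial b u x))"
    unfolding weighted_laplacian_gaussian[abs_def] by simp
  have "partial b (weighted_laplacian (\<lambda>x. exp (- j * (norm x)\<^sup>2)) u) x =
    - (\<Sum>c\<in>Basis. partial b (partial c (partial c u)) x)
    + 2 * j * (\<Sum>c\<in>Basis. (b \<bullet> c) * partial c u x + (x \<bullet> c) * partial b (partial c u) x)"
    unfolding e partial_add[OF 1(1,3)] partial_mult[OF differentiable_const 1(2)]
      partial_mult[OF differentiable_const 1(4)] s1 s2 partial_const by simp
  also have "(\<Sum>c\<in>Basis. (b \<bullet> c) * partial c u x) = (\<Sum>c\<in>Basis. if c = b then partial b u x else 0)"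
    using b by (intro sum.cong) (auto simp: inner_Basis)
  then have "(\<Sum>c\<in>Basis. (b \<bullet> c) * partial c u x + (x \<bullet> c) * partial b (partial c u) x)
      = partial b u x + (\<Sum>c\<in>Basis. (x \<bullet> c) * partial b (partial c u) x)"
    using b by (simp add: sum.distrib)
  finally show ?thesis .
qed

lemma neumann_energy:
  fixes \<Omega> :: "(real^'n) set" and j :: real
  assumes \<Omega>: "open \<Omega>" "\<Omega> \<noteq> {}" "bounded \<Omega>" "convex \<Omega>" "smooth_boundary \<Omega>"
    and v: "smooth v" "neumann_condition \<Omega> v"
    and \<sigma>_def: "\<sigma> = (\<lambda>x. exp (- j * (norm x)\<^sup>2))"
  shows "(LINT x:\<Omega>|lborel. \<sigma> x * (norm (grad v x))\<^sup>2) = (LINT x:\<Omega>|lborel. \<sigma> x * (v x * weighted_laplacian \<sigma> v x))"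
proof -
  have \<sigma>: "smooth \<sigma>" unfolding \<sigma>_def by (rule smooth_gaussian)
  have "smooth (weighted_laplacian \<sigma> v)"
    unfolding \<sigma>_def by (rule smooth_weighted_laplacian_gaussian[OF v(1)])
  then have sm: "smooth (\<lambda>x. \<sigma> x * (norm (grad v x))\<^sup>2)" "smooth (\<lambda>x. \<sigma> x * (v x * weighted_laplacian \<sigma> v x))"
    by (intro smooth_mult \<sigma> v smooth_norm_grad_square)+
  note int = set_integrable_continuous_bounded[OF \<Omega>(1,3) smooth_continuous]
  \<comment> \<open>The factor c makes one computation serve both signs: the Neumann condition makes
    the field tangent to the boundary, so c = 1 and c = -1 are both admissible.\<close>
  have le: "c * ((LINT x:\<Omega>|lborel. \<sigma> x * (norm (grad v x))\<^sup>2)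
      - (LINT x:\<Omega>|lborel. \<sigma> x * (v x * weighted_laplacian \<sigma> v x))) \<le> 0" for c
  proof -
    let ?W = "\<lambda>b x. c * (\<sigma> x * (v x * partial b v x))"
    have div: "(\<Sum>b\<in>Basis. partial b (?W b) x)
        = c * (\<sigma> x * (norm (grad v x))\<^sup>2 - \<sigma> x * (v x * weighted_laplacian \<sigma> v x))" for x
    proof -
      have d: "v differentiable at x" "\<sigma> differentiable at x" using v \<sigma> smoothD by blast+
      have "partial b (?W b) x = c * (\<sigma> x * ((partial b v x)\<^sup>2 + v x * partial b (partial b v) x
          - 2 * j * (x \<bullet> b) * (v x * partial b v x)))" if b: "b \<in> Basis" for b
      proof -
        have d3: "partial b v differentiable at x" using v(1) b smooth_partial smoothD by blast
        have d4: "(\<lambda>x. v x * partial b v x) differentiable at x"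
          "(\<lambda>x. \<sigma> x * (v x * partial b v x)) differentiable at x"
          using d d3 by (auto intro!: differentiable_mult)
        \<comment> \<open>The logarithmic derivative of the weight is minus the drift of L, which is
          why the divergence of \<open>\<sigma>\<close> grad v is -\<open>\<sigma>\<close> L
          v.\<close>
        have ps: "partial b \<sigma> x = - 2 * j * (x \<bullet> b) * \<sigma> x"
          unfolding \<sigma>_def by (rule partial_gaussian)
        show ?thesis
          unfolding partial_mult[OF differentiable_const d4(2)] partial_mult[OF d(2) d4(1)]
            partial_mult[OF d(1) d3] partial_const ps
          by (simp add: algebra_simps power2_eq_square)
      qed
      then have "(\<Sum>b\<in>Basis. partial b (?W b) x) = (\<Sum>b\<in>Basis. c * (\<sigma> x * ((partial b v x)\<^sup>2 + v x * partial b (partial b v) x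
          - 2 * j * (x \<bullet> b) * (v x * partial b v x))))" by (rule sum.cong[OF refl])
      also have "\<dots> = c * (\<sigma> x * ((\<Sum>b\<in>Basis. (partial b v x)\<^sup>2) + v x * (\<Sum>b\<in>Basis. partial b (partial b v) x)
          - 2 * j * v x * (\<Sum>b\<in>Basis. (x \<bullet> b) * partial b v x)))"
        by (simp add: sum_distrib_left sum.distrib sum_subtractf algebra_simps)
      also have "\<dots> = c * (\<sigma> x * (norm (grad v x))\<^sup>2 - \<sigma> x * (v x * weighted_laplacian \<sigma> v x))"
        unfolding norm_grad_square \<sigma>_def weighted_laplacian_gaussian by (simp add: algebra_simps)
      finally show ?thesis .
    qed
    have "(LINT x:\<Omega>|lborel. \<Sum>b\<in>Basis. partial b (?W b) x) \<le> 0"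
    proof (rule integral_divergence_nonpos[OF \<Omega>])
      show "smooth (?W b)" if "b \<in> Basis" for b
        using that by (intro smooth_mult smooth_const \<sigma> v smooth_partial)
      show "(\<Sum>b\<in>Basis. ?W b p * partial b \<rho> p) \<le> 0"
        if "p \<in> frontier \<Omega>" "local_defining_function \<Omega> p \<rho>" for p \<rho>
      proof -
        have "(\<Sum>b\<in>Basis. ?W b p * partial b \<rho> p) = c * (\<sigma> p * v p) * (grad v p \<bullet> grad \<rho> p)"
          unfolding inner_commute[of "grad v p" "grad \<rho> p"] grad_inner[of \<rho>]
          by (simp add: grad_inner_Basis sum_distrib_left mult_ac)
        then show ?thesis using neumann_condition_grad[OF v(2) that] by simp
      qed
    qed
    then show ?thesis
      unfolding div using int[OF sm(1)] int[OF sm(2)] by simp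
  qed
  show ?thesis using le[of 1] le[of "-1"] by simp
qed

text \<open>The field \<open>\<sigma> (D(\<nabla>v)\<nabla>v + (Lv)\<nabla>v)\<close> has weighted divergence
  \<open>|D\<^sup>2v|\<^sup>2 + 2j |\<nabla>v|\<^sup>2 - (Lv)\<^sup>2\<close>: the third derivatives cancel.\<close>

lemma neumann_bochner:
  fixes \<Omega> :: "(real^'n) set" and j :: real
  assumes \<Omega>: "open \<Omega>" "\<Omega> \<noteq> {}" "bounded \<Omega>" "convex \<Omega>" "smooth_boundary \<Omega>"
    and v: "smooth v" "neumann_condition \<Omega> v"
    and \<sigma>_def: "\<sigma> = (\<lambda>x. exp (- j * (norm x)\<^sup>2))"
  shows "2 * j * (LINT x:\<Omega>|lborel. \<sigma> x * (norm (grad v x))\<^sup>2)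
    \<le> (LINT x:\<Omega>|lborel. \<sigma> x * (weighted_laplacian \<sigma> v x)\<^sup>2)"
proof -
  let ?A = "weighted_laplacian \<sigma> v"
  let ?W = "\<lambda>b x. \<sigma> x * ((\<Sum>c\<in>Basis. partial c v x * partial b (partial c v) x) + ?A x * partial b v x)"
  let ?H = "\<lambda>x. \<Sum>b\<in>Basis. \<Sum>c\<in>Basis. (partial b (partial c v) x)\<^sup>2"
  have \<sigma>: "smooth \<sigma>" unfolding \<sigma>_def by (rule smooth_gaussian)
  have A: "smooth ?A" unfolding \<sigma>_def by (rule smooth_weighted_laplacian_gaussian[OF v(1)])
  have comm: "partial b (partial c v) = partial c (partial b v)" if "b \<in> Basis" "c \<in> Basis" for b c
    using partial_commute[OF v(1) that] by blast
  have W: "smooth (?W b)" if "b \<in> Basis" for b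
    using that v by (intro smooth_mult smooth_add smooth_sum smooth_partial \<sigma> A)
  have div: "(\<Sum>b\<in>Basis. partial b (?W b) x) = \<sigma> x * ?H x + 2 * j * (\<sigma> x * (norm (grad v x))\<^sup>2) - \<sigma> x * (?A x)\<^sup>2" for x
  proof -
    let ?v = "\<lambda>b. partial b v x" and ?vv = "\<lambda>b c. partial b (partial c v) x"
      and ?vvv = "\<lambda>b c d. partial b (partial c (partial d v)) x"
    \<comment> \<open>Arranged so that, after summation over b, the third derivatives form one pair
      of opposite sums and the terms containing x another.\<close>
    have pW: "partial b (?W b) x = \<sigma> x * ((\<Sum>c\<in>Basis. (?vv b c)\<^sup>2) + (\<Sum>c\<in>Basis. ?v c * ?vvv b b c)
        - (\<Sum>c\<in>Basis. ?v b * ?vvv b c c)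
        + 2 * j * (?v b)\<^sup>2 + 2 * j * (\<Sum>c\<in>Basis. ?v b * (x \<bullet> c) * ?vv b c)
        - 2 * j * (\<Sum>c\<in>Basis. (x \<bullet> b) * ?v c * ?vv b c)
        + ?A x * (?vv b b - 2 * j * ((x \<bullet> b) * ?v b)))"
      if b: "b \<in> Basis" for b
    proof -
      have sm: "smooth (partial c v)" "smooth (partial b (partial c v))" if "c \<in> Basis" for c
        using v(1) b that smooth_partial by blast+
      have ps: "partial b \<sigma> x = - 2 * j * (x \<bullet> b) * \<sigma> x"
        unfolding \<sigma>_def by (rule partial_gaussian)
      have pA: "partial b ?A x = - (\<Sum>c\<in>Basis. ?vvv b c c) + 2 * j * (?v b + (\<Sum>c\<in>Basis. (x \<bullet> c) * ?vv b c))"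
        unfolding \<sigma>_def by (rule partial_weighted_laplacian_gaussian[OF v(1) b])
      have 1: "smooth (\<lambda>x. \<Sum>c\<in>Basis. partial c v x * partial b (partial c v) x)"
        by (intro smooth_sum smooth_mult sm)
      have 2: "smooth (\<lambda>x. ?A x * partial b v x)" by (intro smooth_mult A sm b)
      have 3: "partial b (\<lambda>x. \<Sum>c\<in>Basis. partial c v x * partial b (partial c v) x) x
          = (\<Sum>c\<in>Basis. (?vv b c)\<^sup>2 + ?v c * ?vvv b b c)"
        using sm by (subst partial_sum)
          (auto intro!: sum.cong smoothD smooth_mult simp: partial_mult smoothD power2_eq_square)
      have 4: "partial b (\<lambda>x. ?A x * partial b v x) x = partial b ?A x * ?v b + ?A x * ?vv b b"
        by (intro partial_mult smoothD A sm b)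
      have W': "partial b (?W b) x = partial b \<sigma> x * ((\<Sum>c\<in>Basis. ?v c * ?vv b c) + ?A x * ?v b)
          + \<sigma> x * ((\<Sum>c\<in>Basis. (?vv b c)\<^sup>2 + ?v c * ?vvv b b c) + (partial b ?A x * ?v b + ?A x * ?vv b b))"
        using partial_mult[OF smoothD[OF \<sigma>] smoothD[OF smooth_add[OF 1 2]], of b x]
        unfolding partial_add[OF smoothD[OF 1] smoothD[OF 2]] 3 4 .
      have S: "(\<Sum>c\<in>Basis. ?v b * ?vvv b c c) = ?v b * (\<Sum>c\<in>Basis. ?vvv b c c)"
        "(\<Sum>c\<in>Basis. ?v b * (x \<bullet> c) * ?vv b c) = ?v b * (\<Sum>c\<in>Basis. (x \<bullet> c) * ?vv b c)"
        "(\<Sum>c\<in>Basis. (x \<bullet> b) * ?v c * ?vv b c) = (x \<bullet> b) * (\<Sum>c\<in>Basis. ?v c * ?vv b c)"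
        by (simp_all only: sum_distrib_left mult.assoc)
      show ?thesis unfolding W' ps pA sum.distrib S by (simp add: algebra_simps power2_eq_square)
    qed
    have "(\<Sum>b\<in>Basis. partial b (?W b) x) = \<sigma> x * (?H x + (\<Sum>b\<in>Basis. \<Sum>c\<in>Basis. ?v c * ?vvv b b c)
        - (\<Sum>b\<in>Basis. \<Sum>c\<in>Basis. ?v b * ?vvv b c c)
        + 2 * j * (\<Sum>b\<in>Basis. (?v b)\<^sup>2) + 2 * j * (\<Sum>b\<in>Basis. \<Sum>c\<in>Basis. ?v b * (x \<bullet> c) * ?vv b c)
        - 2 * j * (\<Sum>b\<in>Basis. \<Sum>c\<in>Basis. (x \<bullet> b) * ?v c * ?vv b c)
        + ?A x * ((\<Sum>b\<in>Basis. ?vv b b) - 2 * j * (\<Sum>b\<in>Basis. (x \<bullet> b) * ?v b)))"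
      by (simp only: sum.cong[OF refl pW] sum.distrib sum_subtractf flip: sum_distrib_left)
    \<comment> \<open>Exchanging the names b and c and commuting derivatives identifies the two sums
      of third derivatives, so they cancel.\<close>
    also have "(\<Sum>b\<in>Basis. \<Sum>c\<in>Basis. ?v b * ?vvv b c c) = (\<Sum>b\<in>Basis. \<Sum>c\<in>Basis. ?v c * ?vvv b b c)"
    proof (subst sum.swap, intro sum.cong refl)
      fix b c :: "real^'n" assume bc: "b \<in> Basis" "c \<in> Basis"
      have "?vvv c b b = ?vvv b c b"
        using partial_commute[OF smooth_partial[OF v(1) bc(1)] bc(2,1)] .
      also have "\<dots> = ?vvv b b c" unfolding comm[OF bc(2,1)] ..
      finally show "?v c * ?vvv c b b = ?v c * ?vvv b b c" by simp
    qed
    also have "(\<Sum>b\<in>Basis. \<Sum>c\<in>Basis. ?v b * (x \<bullet> c) * ?vv b c) = (\<Sum>b\<in>Basis. \<Sum>c\<in>Basis. (x \<bullet> b) * ?v c * ?vv b c)"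
      by (subst sum.swap, intro sum.cong refl) (simp add: comm mult_ac)
    \<comment> \<open>The factor multiplying \<open>?A x\<close> is its own negative, the origin of
      the term -(L v)^2.\<close>
    also have "(\<Sum>b\<in>Basis. ?vv b b) - 2 * j * (\<Sum>b\<in>Basis. (x \<bullet> b) * ?v b) = - ?A x"
      unfolding \<sigma>_def weighted_laplacian_gaussian by simp
    finally show ?thesis
      unfolding norm_grad_square by (simp add: power2_eq_square algebra_simps)
  qed
  have "(LINT x:\<Omega>|lborel. \<Sum>b\<in>Basis. partial b (?W b) x) \<le> 0"
  proof (rule integral_divergence_nonpos[OF \<Omega> W])
    fix p \<rho> assume p: "p \<in> frontier \<Omega>" "local_defining_function \<Omega> p \<rho>"
    \<comment> \<open>Of the two parts of the normal component, the Hessian part is nonpositive by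
      convexity and the other vanishes by the Neumann condition.\<close>
    have "(\<Sum>b\<in>Basis. ?W b p * partial b \<rho> p) = \<sigma> p * (grad \<rho> p \<bullet>
        (\<Sum>b\<in>Basis. (grad (partial b v) p \<bullet> grad v p) *\<^sub>R b) + ?A p * (grad v p \<bullet> grad \<rho> p))"
    proof -
      have 1: "grad \<rho> p \<bullet> (\<Sum>b\<in>Basis. (grad (partial b v) p \<bullet> grad v p) *\<^sub>R b)
        = (\<Sum>b\<in>Basis. (\<Sum>c\<in>Basis. partial c v p * partial b (partial c v) p) * partial b \<rho> p)"
        unfolding grad_inner[of \<rho>]
      proof (intro sum.cong refl arg_cong2[of _ _ _ _ "(*)"])
        fix b :: "real^'n" assume b: "b \<in> Basis"
        have "(\<Sum>b\<in>Basis. (grad (partial b v) p \<bullet> grad v p) *\<^sub>R b) \<bullet> b = grad (partial b v) p \<bullet> grad v p"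
          using b by simp
        also have "\<dots> = (\<Sum>c\<in>Basis. partial c v p * partial b (partial c v) p)"
          unfolding grad_inner[of "partial b v"] by (intro sum.cong refl) (simp add: grad_inner_Basis comm b)
        finally show "(\<Sum>b\<in>Basis. (grad (partial b v) p \<bullet> grad v p) *\<^sub>R b) \<bullet> b
          = (\<Sum>c\<in>Basis. partial c v p * partial b (partial c v) p)" .
      qed
      have 2: "grad v p \<bullet> grad \<rho> p = (\<Sum>b\<in>Basis. partial b v p * partial b \<rho> p)"
        unfolding inner_commute[of "grad v p" "grad \<rho> p"] grad_inner[of \<rho>] by (simp add: grad_inner_Basis)
      show ?thesis unfolding 1 2
        by (simp add: sum_distrib_left sum.distrib algebra_simps)
    qed
    also have "\<dots> \<le> 0"
      using neumann_hessian_boundary[OF \<Omega>(1,4) v p] neumann_condition_grad[OF v(2) p]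
      by (simp add: mult_nonneg_nonpos \<sigma>_def)
    finally show "(\<Sum>b\<in>Basis. ?W b p * partial b \<rho> p) \<le> 0" .
  qed
  note int = set_integrable_continuous_bounded[OF \<Omega>(1,3) smooth_continuous]
  have sm: "smooth (\<lambda>x. \<sigma> x * ?H x)" "smooth (\<lambda>x. \<sigma> x * (norm (grad v x))\<^sup>2)" "smooth (\<lambda>x. \<sigma> x * (?A x)\<^sup>2)"
    by (intro smooth_mult[OF \<sigma>] smooth_sum smooth_power2 smooth_partial v(1) smooth_norm_grad_square A; assumption?)+
  \<comment> \<open>Discarding the squared Hessian leaves the lower bound for the squared norm of L
    v.\<close>
  have "0 \<le> (LINT x:\<Omega>|lborel. \<sigma> x * ?H x)"
    unfolding set_lebesgue_integral_def
    by (intro Bochner_Integration.integral_nonneg)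
       (auto intro!: mult_nonneg_nonneg sum_nonneg simp: \<sigma>_def)
  moreover have "(LINT x:\<Omega>|lborel. \<Sum>b\<in>Basis. partial b (?W b) x) = (LINT x:\<Omega>|lborel. \<sigma> x * ?H x)
      + 2 * j * (LINT x:\<Omega>|lborel. \<sigma> x * (norm (grad v x))\<^sup>2) - (LINT x:\<Omega>|lborel. \<sigma> x * (?A x)\<^sup>2)"
    unfolding div using int[OF sm(1)] int[OF sm(2)] int[OF sm(3)] by simp
  ultimately show ?thesis using \<open>(LINT x:\<Omega>|lborel. \<Sum>b\<in>Basis. partial b (?W b) x) \<le> 0\<close> by linarith
qed

section \<open>Convergence in the weighted space\<close>

lemma L2D: "u \<in> L2 M \<Longrightarrow> u \<in> borel_measurable M" "u \<in> L2 M \<Longrightarrow> integrable M (\<lambda>x. (u x)\<^sup>2)"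
  unfolding L2_def by auto

lemma L2_integrable_mult:
  assumes "u \<in> L2 M" "v \<in> L2 M" shows "integrable M (\<lambda>x. u x * v x)"
proof (rule Bochner_Integration.integrable_bound)
  show "integrable M (\<lambda>x. (u x)\<^sup>2 + (v x)\<^sup>2)" using assms by (intro Bochner_Integration.integrable_add L2D)
  show "(\<lambda>x. u x * v x) \<in> borel_measurable M" using assms by (intro borel_measurable_times L2D)
  have "\<bar>a * b\<bar> \<le> a\<^sup>2 + b\<^sup>2" for a b :: real
  proof -
    have "2 * (\<bar>a\<bar> * \<bar>b\<bar>) \<le> a\<^sup>2 + b\<^sup>2"
      using sum_squares_bound[of "\<bar>a\<bar>" "\<bar>b\<bar>"] by (simp add: mult.assoc)
    moreover have "0 \<le> \<bar>a\<bar> * \<bar>b\<bar>" by simp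
    ultimately show ?thesis unfolding abs_mult by linarith
  qed
  then show "AE x in M. norm (u x * v x) \<le> norm ((u x)\<^sup>2 + (v x)\<^sup>2)" by simp
qed

lemma L2_add_scaled:
  assumes "u \<in> L2 M" "v \<in> L2 M" shows "(\<lambda>x. u x + t * v x) \<in> L2 M"
proof -
  have "integrable M (\<lambda>x. (u x)\<^sup>2 + 2 * t * (u x * v x) + t\<^sup>2 * (v x)\<^sup>2)"
    using assms by (intro Bochner_Integration.integrable_add integrable_mult_right L2_integrable_mult L2D)
  moreover have "(u x)\<^sup>2 + 2 * t * (u x * v x) + t\<^sup>2 * (v x)\<^sup>2 = (u x + t * v x)\<^sup>2" for x
    by (simp add: power2_eq_square algebra_simps)
  moreover have "(\<lambda>x. u x + t * v x) \<in> borel_measurable M"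
    using assms by (intro borel_measurable_add borel_measurable_times borel_measurable_const L2D)
  ultimately show ?thesis unfolding L2_def by simp
qed

lemma L2_diff: "u \<in> L2 M \<Longrightarrow> v \<in> L2 M \<Longrightarrow> (\<lambda>x. u x - v x) \<in> L2 M"
  using L2_add_scaled[of u M v "-1"] by simp

text \<open>The integral of (u + t v)^2 is nonnegative for all t. It is evaluated at the minimizer t
  = -B / C or, when C = 0, at a t where the then affine function of t would equal -1 if B were
  nonzero.\<close>

lemma L2_Cauchy_Schwarz:
  assumes "u \<in> L2 M" "v \<in> L2 M"
  shows "(\<integral>x. u x * v x \<partial>M)\<^sup>2 \<le> (\<integral>x. (u x)\<^sup>2 \<partial>M) * (\<integral>x. (v x)\<^sup>2 \<partial>M)"
proof -
  let ?A = "\<integral>x. (u x)\<^sup>2 \<partial>M" and ?B = "\<integral>x. u x * v x \<partial>M" and ?C = "\<integral>x. (v x)\<^sup>2 \<partial>M"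
  have q: "0 \<le> ?A + 2 * t * ?B + t\<^sup>2 * ?C" for t
  proof -
    have "0 \<le> (\<integral>x. (u x + t * v x)\<^sup>2 \<partial>M)" by simp
    also have "(\<lambda>x. (u x + t * v x)\<^sup>2) = (\<lambda>x. (u x)\<^sup>2 + 2 * t * (u x * v x) + t\<^sup>2 * (v x)\<^sup>2)"
      by (simp add: fun_eq_iff power2_eq_square algebra_simps)
    also have "(\<integral>x. (u x)\<^sup>2 + 2 * t * (u x * v x) + t\<^sup>2 * (v x)\<^sup>2 \<partial>M) = ?A + 2 * t * ?B + t\<^sup>2 * ?C"
      using L2D(2)[OF assms(1)] L2D(2)[OF assms(2)] L2_integrable_mult[OF assms] by simp
    finally show ?thesis .
  qed
  have C: "?C \<ge> 0" by simp
  show ?thesis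
  proof (cases "?C = 0")
    case True
    have "?B = 0"
    proof (rule ccontr)
      assume "?B \<noteq> 0"
      then have "?A + 2 * (- (?A + 1) / (2 * ?B)) * ?B = - 1" by (simp add: field_simps)
      then show False using q[of "- (?A + 1) / (2 * ?B)"] True by simp
    qed
    then show ?thesis using True by simp
  next
    case False
    then have "?A + 2 * (- ?B / ?C) * ?B + (- ?B / ?C)\<^sup>2 * ?C = ?A - ?B\<^sup>2 / ?C"
      by (simp add: power2_eq_square field_simps)
    then have "?B\<^sup>2 / ?C \<le> ?A" using q[of "- ?B / ?C"] by linarith
    moreover have "?C > 0" using C False by linarith
    ultimately show ?thesis by (simp only: pos_divide_le_eq)
  qed
qed

text \<open>v w - u g splits into (v - u)(w - g) + u (w - g) + (v - u) g, and Cauchy-Schwarz sends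
  each integral to 0. This carries the energy relations to the limit.\<close>

lemma L2_tendsto_mult:
  assumes v: "L2_tendsto M v u" and w: "L2_tendsto M w g"
  shows "(\<lambda>m. \<integral>x. v m x * w m x \<partial>M) \<longlonglongrightarrow> (\<integral>x. u x * g x \<partial>M)"
proof -
  have L: "v m \<in> L2 M" "w m \<in> L2 M" "u \<in> L2 M" "g \<in> L2 M"
    and lim: "(\<lambda>m. \<integral>x. (v m x - u x)\<^sup>2 \<partial>M) \<longlonglongrightarrow> 0" "(\<lambda>m. \<integral>x. (w m x - g x)\<^sup>2 \<partial>M) \<longlonglongrightarrow> 0" for m
    using v w unfolding L2_tendsto_def by auto
  have zero: "(\<lambda>m. \<integral>x. a m x * b m x \<partial>M) \<longlonglongrightarrow> 0"
    if "\<And>m. a m \<in> L2 M" "\<And>m. b m \<in> L2 M"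
      "(\<lambda>m. (\<integral>x. (a m x)\<^sup>2 \<partial>M) * (\<integral>x. (b m x)\<^sup>2 \<partial>M)) \<longlonglongrightarrow> 0" for a b :: "nat \<Rightarrow> 'a \<Rightarrow> real"
  proof -
    have "(\<lambda>m. (\<integral>x. a m x * b m x \<partial>M)\<^sup>2) \<longlonglongrightarrow> 0"
      by (rule tendsto_sandwich[OF _ _ tendsto_const that(3)])
         (intro always_eventually allI zero_le_power2 L2_Cauchy_Schwarz that(1,2))+
    from tendsto_real_sqrt[OF this] show ?thesis by (simp add: tendsto_rabs_zero_iff)
  qed
  have 1: "(\<lambda>m. \<integral>x. (v m x - u x) * (w m x - g x) \<partial>M) \<longlonglongrightarrow> 0"
    using tendsto_mult_zero[OF lim] by (intro zero L2_diff L)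
  have 2: "(\<lambda>m. \<integral>x. u x * (w m x - g x) \<partial>M) \<longlonglongrightarrow> 0"
    using tendsto_mult_right_zero[OF lim(2)] by (intro zero L2_diff L)
  have 3: "(\<lambda>m. \<integral>x. (v m x - u x) * g x \<partial>M) \<longlonglongrightarrow> 0"
    using tendsto_mult_left_zero[OF lim(1)] by (intro zero L2_diff L)
  have eq: "(\<integral>x. v m x * w m x \<partial>M) = (\<integral>x. (v m x - u x) * (w m x - g x) \<partial>M)
      + (\<integral>x. u x * (w m x - g x) \<partial>M) + (\<integral>x. (v m x - u x) * g x \<partial>M) + (\<integral>x. u x * g x \<partial>M)" for m
  proof -
    have "integrable M (\<lambda>x. (v m x - u x) * (w m x - g x))" "integrable M (\<lambda>x. u x * (w m x - g x))"
      "integrable M (\<lambda>x. (v m x - u x) * g x)" "integrable M (\<lambda>x. u x * g x)"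
      by (intro L2_integrable_mult L2_diff L)+
    then have "(\<integral>x. (v m x - u x) * (w m x - g x) \<partial>M)
      + (\<integral>x. u x * (w m x - g x) \<partial>M) + (\<integral>x. (v m x - u x) * g x \<partial>M) + (\<integral>x. u x * g x \<partial>M)
      = (\<integral>x. (v m x - u x) * (w m x - g x) + u x * (w m x - g x) + (v m x - u x) * g x + u x * g x \<partial>M)"
      by simp
    also have "\<dots> = (\<integral>x. v m x * w m x \<partial>M)"
      by (intro Bochner_Integration.integral_cong) (auto simp: algebra_simps)
    finally show ?thesis by simp
  qed
  show ?thesis unfolding eq using tendsto_add[OF tendsto_add[OF tendsto_add[OF 1 2] 3] tendsto_const] by simp
qed

lemma integral_weighted_measure:
  fixes f \<sigma> :: "'a::euclidean_space \<Rightarrow> real"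
  assumes "open \<Omega>" "\<sigma> \<in> borel_measurable borel" "\<And>x. \<sigma> x \<ge> 0" "f \<in> borel_measurable borel"
  shows "(\<integral>x. f x \<partial>weighted_measure \<Omega> \<sigma>) = (LINT x:\<Omega>|lborel. \<sigma> x * f x)"
  unfolding weighted_measure_def set_lebesgue_integral_def
  using assms by (subst integral_density) (auto simp: mult.assoc)

section \<open>Increments along segments and almost everywhere constancy\<close>

lemma square_increment_le:
  fixes \<gamma> :: "real \<Rightarrow> real"
  assumes ab: "a \<le> b" and \<gamma>: "\<And>t. (\<gamma> has_real_derivative \<gamma>' t) (at t)" and cont: "continuous_on UNIV \<gamma>'"
  shows "ennreal ((\<gamma> b - \<gamma> a)\<^sup>2) \<le> ennreal (b - a) * (\<integral>\<^sup>+t\<in>{a..b}. ennreal ((\<gamma>' t)\<^sup>2) \<partial>lborel)"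
proof (cases "a = b")
  case False
  define \<Delta> where "\<Delta> = \<gamma> b - \<gamma> a"
  define I where "I = integral {a..b} (\<lambda>t. (\<gamma>' t)\<^sup>2)"
  \<comment> \<open>The mean slope: integrating \<open>(\<gamma>' t - c)\<^sup>2 \<ge> 0\<close>
    gives Cauchy-Schwarz in the form \<open>\<Delta>\<^sup>2 \<le> (b - a) * I\<close>.\<close>
  define c where "c = \<Delta> / (b - a)"
  have cont2: "continuous_on {a..b} (\<lambda>t. (\<gamma>' t)\<^sup>2)"
    using cont by (intro continuous_on_power) (rule continuous_on_subset, auto)
  have I: "((\<lambda>t. (\<gamma>' t)\<^sup>2) has_integral I) {a..b}"
    unfolding I_def by (intro integrable_integral integrable_continuous_real cont2)
  have D: "(\<gamma>' has_integral \<Delta>) {a..b}"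
    unfolding \<Delta>_def using ab \<gamma>
    by (intro fundamental_theorem_of_calculus) (auto intro: DERIV_subset simp: has_real_derivative_iff_has_vector_derivative[symmetric])
  have "((\<lambda>t. (\<gamma>' t)\<^sup>2 - 2 * c * \<gamma>' t + c\<^sup>2) has_integral (I - 2 * c * \<Delta> + c\<^sup>2 * (b - a))) {a..b}"
    using has_integral_const_real[of "c\<^sup>2" a b] ab
    by (intro has_integral_add has_integral_diff has_integral_mult_right I D) (simp add: mult.commute)
  then have "0 \<le> I - 2 * c * \<Delta> + c\<^sup>2 * (b - a)"
  proof (rule has_integral_nonneg)
    fix t
    have "(\<gamma>' t)\<^sup>2 - 2 * c * \<gamma>' t + c\<^sup>2 = (\<gamma>' t - c)\<^sup>2" by (simp add: power2_eq_square algebra_simps)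
    then show "0 \<le> (\<gamma>' t)\<^sup>2 - 2 * c * \<gamma>' t + c\<^sup>2" by simp
  qed
  also have "I - 2 * c * \<Delta> + c\<^sup>2 * (b - a) = I - \<Delta>\<^sup>2 / (b - a)"
  proof -
    have "c * (b - a) = \<Delta>" using False by (simp add: c_def)
    then have "c\<^sup>2 * (b - a) = c * \<Delta>" by (simp add: power2_eq_square mult.assoc)
    moreover have "\<Delta>\<^sup>2 / (b - a) = c * \<Delta>" by (simp add: c_def power2_eq_square)
    ultimately show ?thesis by simp
  qed
  finally have "\<Delta>\<^sup>2 \<le> (b - a) * I" using ab False by (simp add: pos_divide_le_eq mult.commute)
  moreover have "(\<integral>\<^sup>+t\<in>{a..b}. ennreal ((\<gamma>' t)\<^sup>2) \<partial>lborel) = ennreal I"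
    using borel_measurable_continuous_onI[OF cont] by (intro nn_integral_has_integral_lebesgue' I) auto
  moreover have "I \<ge> 0" using I by (rule has_integral_nonneg) simp
  ultimately show ?thesis using ab by (simp add: \<Delta>_def ennreal_mult'[symmetric] ennreal_leI)
qed simp

lemma nn_integral_lborel_affine:
  fixes f :: "'a::euclidean_space \<Rightarrow> ennreal"
  assumes [measurable]: "f \<in> borel_measurable borel" and c: "c \<noteq> 0"
  shows "(\<integral>\<^sup>+x. f x \<partial>lborel) = ennreal (\<bar>c\<bar> ^ DIM('a)) * (\<integral>\<^sup>+x. f (t + c *\<^sub>R x) \<partial>lborel)"
  by (subst lborel_affine[OF c, of t]) (simp add: nn_integral_density nn_integral_distr nn_integral_cmult)

text \<open>The contraction towards p maps the convex domain into itself with Jacobian t^n, and t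
  \<ge> 1 / 2 keeps the inverse Jacobian at most 2^n.\<close>

lemma nn_integral_contraction_le:
  fixes f :: "'a::euclidean_space \<Rightarrow> ennreal"
  assumes [measurable]: "f \<in> borel_measurable borel" and \<Omega>: "open \<Omega>" "convex \<Omega>" "p \<in> \<Omega>"
    and t: "1 / 2 \<le> t" "t \<le> 1"
  shows "(\<integral>\<^sup>+x\<in>\<Omega>. f (p + t *\<^sub>R (x - p)) \<partial>lborel) \<le> ennreal (2 ^ DIM('a)) * (\<integral>\<^sup>+x\<in>\<Omega>. f x \<partial>lborel)"
proof -
  have [measurable]: "\<Omega> \<in> sets borel" using \<Omega>(1) by simp
  have eq: "(p - t *\<^sub>R p) + t *\<^sub>R x = p + t *\<^sub>R (x - p)" for x by (simp add: algebra_simps)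
  have mem: "p + t *\<^sub>R (x - p) \<in> \<Omega>" if "x \<in> \<Omega>" for x
  proof -
    have "(1 - t) *\<^sub>R p + t *\<^sub>R x \<in> \<Omega>" using t that by (intro convexD[OF \<Omega>(2,3)]) auto
    then show ?thesis by (simp add: algebra_simps)
  qed
  have "(\<integral>\<^sup>+x\<in>\<Omega>. f (p + t *\<^sub>R (x - p)) \<partial>lborel)
      \<le> (\<integral>\<^sup>+x. f (p + t *\<^sub>R (x - p)) * indicator \<Omega> (p + t *\<^sub>R (x - p)) \<partial>lborel)"
    using mem by (intro nn_integral_mono) (auto simp: indicator_def)
  also have "\<dots> \<le> ennreal (2 ^ DIM('a)) * (ennreal (\<bar>t\<bar> ^ DIM('a)) *
      (\<integral>\<^sup>+x. f (p + t *\<^sub>R (x - p)) * indicator \<Omega> (p + t *\<^sub>R (x - p)) \<partial>lborel))" (is "?I \<le> _")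
  proof -
    have "(1::real) \<le> (2 * t) ^ DIM('a)" using t by (intro one_le_power) simp
    also have "\<dots> = 2 ^ DIM('a) * \<bar>t\<bar> ^ DIM('a)" using t by (simp add: power_mult_distrib)
    finally have "ennreal 1 \<le> ennreal (2 ^ DIM('a) * \<bar>t\<bar> ^ DIM('a))" by (rule ennreal_leI)
    also have "\<dots> = ennreal (2 ^ DIM('a)) * ennreal (\<bar>t\<bar> ^ DIM('a))" by (rule ennreal_mult) simp_all
    finally have "1 \<le> ennreal (2 ^ DIM('a)) * ennreal (\<bar>t\<bar> ^ DIM('a))" by simp
    then have "1 * ?I \<le> (ennreal (2 ^ DIM('a)) * ennreal (\<bar>t\<bar> ^ DIM('a))) * ?I" by (rule mult_right_mono) simp
    then show ?thesis by (simp add: mult.assoc)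
  qed
  also have "ennreal (\<bar>t\<bar> ^ DIM('a)) * ?I = (\<integral>\<^sup>+x\<in>\<Omega>. f x \<partial>lborel)"
    using nn_integral_lborel_affine[of "\<lambda>x. f x * indicator \<Omega> x" t "p - t *\<^sub>R p"] t
    unfolding eq by simp
  finally show ?thesis .
qed

text \<open>The derivative of v is integrated along the segment from the midpoint of p and x to x;
  Fubini and a contraction for each fixed t bring the gradient back to the domain. Stopping at the
  midpoint keeps t away from 0, where the Jacobian t^n degenerates.\<close>

lemma midpoint_increment_le:
  fixes v :: "'a::euclidean_space \<Rightarrow> real"
  assumes v: "smooth v" and \<Omega>: "open \<Omega>" "convex \<Omega>" "p \<in> \<Omega>" and B: "\<And>x. x \<in> \<Omega> \<Longrightarrow> norm (x - p) \<le> B"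
  shows "(\<integral>\<^sup>+x\<in>\<Omega>. ennreal ((v x - v (p + (1 / 2) *\<^sub>R (x - p)))\<^sup>2) \<partial>lborel)
    \<le> ennreal (B\<^sup>2 * 2 ^ DIM('a)) * (\<integral>\<^sup>+x\<in>\<Omega>. ennreal ((norm (grad v x))\<^sup>2) \<partial>lborel)"
proof -
  have [measurable]: "\<Omega> \<in> sets borel" using \<Omega>(1) by simp
  have [measurable]: "grad v \<in> borel_measurable borel" "v \<in> borel_measurable borel"
    using v by (auto intro: borel_measurable_continuous_onI continuous_on_grad smooth_continuous)
  let ?G = "\<lambda>x. ennreal ((norm (grad v x))\<^sup>2)"
  let ?J = "\<integral>\<^sup>+x\<in>\<Omega>. ?G x \<partial>lborel"
  have "ennreal ((v x - v (p + (1 / 2) *\<^sub>R (x - p)))\<^sup>2) * indicator \<Omega> x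
      \<le> ennreal (B\<^sup>2) * (\<integral>\<^sup>+t\<in>{1/2..1}. (?G (p + t *\<^sub>R (x - p)) * indicator \<Omega> x) \<partial>lborel)" for x
  proof (cases "x \<in> \<Omega>")
    case True
    let ?g = "\<lambda>t. v (p + t *\<^sub>R (x - p))" and ?g' = "\<lambda>t. grad v (p + t *\<^sub>R (x - p)) \<bullet> (x - p)"
    have "continuous_on UNIV ?g'"
      by (intro continuous_on_inner continuous_on_compose2[OF continuous_on_grad[OF v, of UNIV]] continuous_intros) auto
    then have "ennreal ((?g 1 - ?g (1/2))\<^sup>2) \<le> ennreal (1 - 1/2) * (\<integral>\<^sup>+t\<in>{1/2..1}. ennreal ((?g' t)\<^sup>2) \<partial>lborel)"
      using v by (intro square_increment_le has_real_derivative_along_line smoothD) auto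
    also have "\<dots> \<le> 1 * (\<integral>\<^sup>+t\<in>{1/2..1}. ennreal ((?g' t)\<^sup>2) \<partial>lborel)"
      by (intro mult_right_mono) (use ennreal_leI[of "1 - 1 / 2" 1] in simp_all)
    also have "\<dots> \<le> (\<integral>\<^sup>+t. ennreal (B\<^sup>2) * (?G (p + t *\<^sub>R (x - p)) * indicator {1/2..1} t) \<partial>lborel)"
      unfolding mult_1
    proof (intro nn_integral_mono)
      fix t
      have "\<bar>?g' t\<bar> \<le> norm (grad v (p + t *\<^sub>R (x - p))) * norm (x - p)" by (rule Cauchy_Schwarz_ineq2)
      also have "\<dots> \<le> norm (grad v (p + t *\<^sub>R (x - p))) * B" using B[OF True] by (intro mult_left_mono) auto
      finally have "\<bar>?g' t\<bar>\<^sup>2 \<le> (norm (grad v (p + t *\<^sub>R (x - p))) * B)\<^sup>2" by (intro power_mono) auto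
      then have "ennreal ((?g' t)\<^sup>2) \<le> ennreal (B\<^sup>2) * ?G (p + t *\<^sub>R (x - p))"
        by (simp add: ennreal_mult'[symmetric] power_mult_distrib mult.commute ennreal_leI)
      then show "ennreal ((?g' t)\<^sup>2) * indicator {1/2..1} t
          \<le> ennreal (B\<^sup>2) * (?G (p + t *\<^sub>R (x - p)) * indicator {1/2..1} t)"
        by (auto simp: indicator_def)
    qed
    also have "\<dots> = ennreal (B\<^sup>2) * (\<integral>\<^sup>+t\<in>{1/2..1}. ?G (p + t *\<^sub>R (x - p)) \<partial>lborel)"
      by (rule nn_integral_cmult) measurable
    finally show ?thesis using True by simp
  qed simp
  then have "(\<integral>\<^sup>+x\<in>\<Omega>. ennreal ((v x - v (p + (1 / 2) *\<^sub>R (x - p)))\<^sup>2) \<partial>lborel)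
    \<le> (\<integral>\<^sup>+x. ennreal (B\<^sup>2) * (\<integral>\<^sup>+t\<in>{1/2..1}. (?G (p + t *\<^sub>R (x - p)) * indicator \<Omega> x) \<partial>lborel) \<partial>lborel)"
    by (rule nn_integral_mono)
  also have "\<dots> = ennreal (B\<^sup>2) * (\<integral>\<^sup>+x. (\<integral>\<^sup>+t. ?G (p + t *\<^sub>R (x - p)) * indicator \<Omega> x * indicator {1/2..1} t \<partial>lborel) \<partial>lborel)"
    by (rule nn_integral_cmult) measurable
  also have "(\<integral>\<^sup>+x. (\<integral>\<^sup>+t. ?G (p + t *\<^sub>R (x - p)) * indicator \<Omega> x * indicator {1/2..1} t \<partial>lborel) \<partial>lborel)
    = (\<integral>\<^sup>+t. (\<integral>\<^sup>+x. ?G (p + t *\<^sub>R (x - p)) * indicator \<Omega> x * indicator {1/2..1} t \<partial>lborel) \<partial>lborel)"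
    by (rule lborel_pair.Fubini') measurable
  also have "\<dots> \<le> (\<integral>\<^sup>+t. ennreal (2 ^ DIM('a)) * ?J * indicator {1/2..1::real} t \<partial>lborel)"
  proof (intro nn_integral_mono)
    fix t :: real
    show "(\<integral>\<^sup>+x. ?G (p + t *\<^sub>R (x - p)) * indicator \<Omega> x * indicator {1/2..1} t \<partial>lborel)
        \<le> ennreal (2 ^ DIM('a)) * ?J * indicator {1/2..1} t"
      using nn_integral_contraction_le[of ?G, OF _ \<Omega>, of t] by (auto simp: indicator_def)
  qed
  also have "\<dots> = ennreal (2 ^ DIM('a)) * ?J * ennreal (1/2)"
    by (subst nn_integral_cmult_indicator) (simp_all add: field_simps)
  also have "\<dots> \<le> ennreal (2 ^ DIM('a)) * ?J * 1"
    by (intro mult_left_mono) (use ennreal_leI[of "1 / 2" 1] in simp_all)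
  finally show ?thesis by (simp add: ennreal_mult mult.assoc mult_left_mono)
qed

lemma square_sum3_le: "(a + b + c)\<^sup>2 \<le> 3 * (a\<^sup>2 + b\<^sup>2 + c\<^sup>2)" for a b c :: real
proof -
  have "3 * (a\<^sup>2 + b\<^sup>2 + c\<^sup>2) - (a + b + c)\<^sup>2 = (a - b)\<^sup>2 + (b - c)\<^sup>2 + (a - c)\<^sup>2"
    by (simp add: power2_eq_square algebra_simps)
  moreover have "0 \<le> (a - b)\<^sup>2 + (b - c)\<^sup>2 + (a - c)\<^sup>2" by simp
  ultimately show ?thesis by linarith
qed

text \<open>With T x the midpoint of p and x, u(x) - u(T x) = (u - v)(x) + (v(x) - v(T x)) + (v -
  u)(T x) for v = v m. The first term tends to 0 in L2, the last one too by the contraction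
  estimate, and the middle one by the gradient bound.\<close>

lemma AE_eq_midpoint:
  fixes \<Omega> :: "'a::euclidean_space set"
  assumes \<Omega>: "open \<Omega>" "bounded \<Omega>" "convex \<Omega>" "p \<in> \<Omega>"
    and u: "u \<in> borel_measurable borel" and v: "\<And>m. smooth (v m)"
    and a: "\<And>m. (\<integral>\<^sup>+x\<in>\<Omega>. ennreal ((v m x - u x)\<^sup>2) \<partial>lborel) \<le> ennreal (a m)" "a \<longlonglongrightarrow> 0" "\<And>m. a m \<ge> 0"
    and b: "\<And>m. (\<integral>\<^sup>+x\<in>\<Omega>. ennreal ((norm (grad (v m) x))\<^sup>2) \<partial>lborel) \<le> ennreal (b m)" "b \<longlonglongrightarrow> 0" "\<And>m. b m \<ge> 0"
  shows "AE x in lborel. x \<in> \<Omega> \<longrightarrow> u x = u (p + (1 / 2) *\<^sub>R (x - p))"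
proof -
  have [measurable]: "\<Omega> \<in> sets borel" using \<Omega>(1) by simp
  note u[measurable]
  have [measurable]: "v m \<in> borel_measurable borel" for m
    by (intro borel_measurable_continuous_onI smooth_continuous v)
  let ?T = "\<lambda>x. p + (1 / 2) *\<^sub>R (x - p)"
  obtain R where R: "\<And>x. x \<in> \<Omega> \<Longrightarrow> norm x \<le> R" using \<Omega>(2) unfolding bounded_iff by blast
  define B where "B = R + norm p"
  have B: "norm (x - p) \<le> B" if "x \<in> \<Omega>" for x
    using norm_triangle_ineq4[of x p] R[OF that] by (simp add: B_def)
  define C where "C = B\<^sup>2 * 2 ^ DIM('a)"
  have C: "C \<ge> 0" by (simp add: C_def)
  let ?K = "\<integral>\<^sup>+x\<in>\<Omega>. ennreal ((u x - u (?T x))\<^sup>2) \<partial>lborel"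
  \<comment> \<open>The factor 3 comes from \<open>square_sum3_le\<close>; the summands bound the
    three pieces in turn.\<close>
  let ?r = "\<lambda>m. 3 * (a m + C * b m + 2 ^ DIM('a) * a m)"
  have K_le: "?K \<le> ennreal (?r m)" for m
  proof -
    let ?f = "\<lambda>x. ennreal ((v m x - u x)\<^sup>2)" and ?g = "\<lambda>x. ennreal ((v m x - v m (?T x))\<^sup>2)"
    have "?K \<le> (\<integral>\<^sup>+x. 3 * (?f x * indicator \<Omega> x + ?g x * indicator \<Omega> x + ?f (?T x) * indicator \<Omega> x) \<partial>lborel)"
    proof (intro nn_integral_mono)
      fix x
      have "(u x - u (?T x))\<^sup>2 = ((u x - v m x) + (v m x - v m (?T x)) + (v m (?T x) - u (?T x)))\<^sup>2" by simp
      also have "\<dots> \<le> 3 * ((u x - v m x)\<^sup>2 + (v m x - v m (?T x))\<^sup>2 + (v m (?T x) - u (?T x))\<^sup>2)"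
        by (rule square_sum3_le)
      finally have "ennreal ((u x - u (?T x))\<^sup>2)
          \<le> ennreal (3 * ((v m x - u x)\<^sup>2 + (v m x - v m (?T x))\<^sup>2 + (v m (?T x) - u (?T x))\<^sup>2))"
        by (simp only: power2_commute[of "u x" "v m x"] ennreal_leI)
      also have "\<dots> = 3 * (?f x + ?g x + ?f (?T x))"
        by (simp add: ennreal_mult ennreal_plus)
      finally show "ennreal ((u x - u (?T x))\<^sup>2) * indicator \<Omega> x
          \<le> 3 * (?f x * indicator \<Omega> x + ?g x * indicator \<Omega> x + ?f (?T x) * indicator \<Omega> x)"
        by (cases "x \<in> \<Omega>") simp_all
    qed
    also have "\<dots> = 3 * ((\<integral>\<^sup>+x\<in>\<Omega>. ?f x \<partial>lborel) + (\<integral>\<^sup>+x\<in>\<Omega>. ?g x \<partial>lborel) + (\<integral>\<^sup>+x\<in>\<Omega>. ?f (?T x) \<partial>lborel))"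
      by (simp add: nn_integral_cmult nn_integral_add)
    also have "\<dots> \<le> 3 * (ennreal (a m) + ennreal C * ennreal (b m) + ennreal (2 ^ DIM('a)) * ennreal (a m))"
    proof (intro mult_left_mono add_mono a(1))
      have "(\<integral>\<^sup>+x\<in>\<Omega>. ?g x \<partial>lborel) \<le> ennreal C * (\<integral>\<^sup>+x\<in>\<Omega>. ennreal ((norm (grad (v m) x))\<^sup>2) \<partial>lborel)"
        unfolding C_def by (rule midpoint_increment_le[OF v \<Omega>(1,3,4) B])
      also have "\<dots> \<le> ennreal C * ennreal (b m)" by (intro mult_left_mono b(1)) simp
      finally show "(\<integral>\<^sup>+x\<in>\<Omega>. ?g x \<partial>lborel) \<le> ennreal C * ennreal (b m)" .
      have "(\<integral>\<^sup>+x\<in>\<Omega>. ?f (?T x) \<partial>lborel) \<le> ennreal (2 ^ DIM('a)) * (\<integral>\<^sup>+x\<in>\<Omega>. ?f x \<partial>lborel)"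
        by (rule nn_integral_contraction_le[of ?f, OF _ \<Omega>(1,3,4)]) simp_all
      also have "\<dots> \<le> ennreal (2 ^ DIM('a)) * ennreal (a m)" by (intro mult_left_mono a(1)) simp
      finally show "(\<integral>\<^sup>+x\<in>\<Omega>. ?f (?T x) \<partial>lborel) \<le> ennreal (2 ^ DIM('a)) * ennreal (a m)" .
    qed simp
    also have "\<dots> = ennreal (?r m)"
    proof -
      have 1: "ennreal (?r m) = ennreal 3 * ennreal (a m + C * b m + 2 ^ DIM('a) * a m)"
        using a(3) b(3) C by (intro ennreal_mult) auto
      have 2: "ennreal (a m + C * b m + 2 ^ DIM('a) * a m)
          = ennreal (a m) + ennreal (C * b m) + ennreal (2 ^ DIM('a) * a m)"
        using a(3) b(3) C by (simp only: ennreal_plus add_nonneg_nonneg mult_nonneg_nonneg zero_le_power zero_le_numeral)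
      have 3: "ennreal (C * b m) = ennreal C * ennreal (b m)" using C b(3) by (rule ennreal_mult)
      have 4: "ennreal (2 ^ DIM('a) * a m) = ennreal (2 ^ DIM('a)) * ennreal (a m)"
        using a(3) by (intro ennreal_mult) auto
      show ?thesis unfolding 1 2 3 4 by simp
    qed
    finally show ?thesis .
  qed
  have "?r \<longlonglongrightarrow> 3 * (0 + C * 0 + 2 ^ DIM('a) * 0)" by (intro tendsto_intros a b)
  then have "(\<lambda>m. ennreal (?r m)) \<longlonglongrightarrow> ennreal 0" by (intro tendsto_ennrealI) simp
  then have "?K \<le> ennreal 0"
    by (rule LIMSEQ_le_const) (use K_le in blast)
  then have "?K = 0" by simp
  then have "AE x in lborel. ennreal ((u x - u (?T x))\<^sup>2) * indicator \<Omega> x = 0"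
    by (subst (asm) nn_integral_0_iff_AE) simp_all
  then show ?thesis
    by eventually_elim (auto simp: indicator_def)
qed

text \<open>By Fubini, for almost every pair (p, x) the relation also holds with p and x exchanged.
  Both orders have the same midpoint, so u(x) = u(p); fixing one such p in the domain gives the
  constant.\<close>

lemma AE_constant_of_AE_midpoint:
  fixes \<Omega> :: "'a::euclidean_space set" and u :: "'a \<Rightarrow> real"
  assumes \<Omega>: "open \<Omega>" "\<Omega> \<noteq> {}" and u[measurable]: "u \<in> borel_measurable borel"
    and mid: "\<And>p. p \<in> \<Omega> \<Longrightarrow> AE x in lborel. x \<in> \<Omega> \<longrightarrow> u x = u (p + (1 / 2) *\<^sub>R (x - p))"
  shows "\<exists>c. AE x in lborel. x \<in> \<Omega> \<longrightarrow> u x = c"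
proof -
  have [measurable]: "\<Omega> \<in> sets borel" using \<Omega>(1) by simp
  let ?P = "\<lambda>p x. p \<in> \<Omega> \<and> x \<in> \<Omega> \<longrightarrow> u x = u (p + (1 / 2) *\<^sub>R (x - p))"
  have 1: "AE p in lborel. AE x in lborel. ?P p x"
  proof (rule AE_I2)
    show "AE x in lborel. ?P p x" for p using mid[of p] by (cases "p \<in> \<Omega>") simp_all
  qed
  have "{z \<in> space (lborel \<Otimes>\<^sub>M lborel). ?P (fst z) (snd z)} \<in> sets (lborel \<Otimes>\<^sub>M lborel)"
    by measurable
  then have "(AE p in lborel. AE x in lborel. ?P p x) \<longleftrightarrow> (AE x in lborel. AE p in lborel. ?P p x)"
    by (rule lborel_pair.AE_commute)
  with 1 have 2: "AE p in lborel. AE x in lborel. ?P x p" by blast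
  have 3: "AE p in lborel. AE x in lborel. p \<in> \<Omega> \<and> x \<in> \<Omega> \<longrightarrow> u x = u p"
    using 1 2
  proof eventually_elim
    case (elim p)
    from elim show ?case
    proof eventually_elim
      case (elim x)
      have "p + (1 / 2) *\<^sub>R (x - p) = x + (1 / 2) *\<^sub>R (p - x)"
        by (simp add: algebra_simps flip: scaleR_add_left)
      then show ?case using elim by auto
    qed
  qed
  \<comment> \<open>A nonempty open set is not null, so one of the good points p lies in the
    domain.\<close>
  have 4: "\<not> (AE p in lborel. p \<notin> \<Omega>)"
  proof
    assume "AE p in lborel. p \<notin> \<Omega>"
    then have "\<Omega> \<in> null_sets lborel" by (subst (asm) AE_iff_null_sets[symmetric]) simp_all
    then have "negligible \<Omega>" by (simp add: negligible_iff_null_sets null_sets_completionI)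
    then show False using open_not_negligible[OF \<Omega>] by blast
  qed
  have "\<exists>p. p \<in> \<Omega> \<and> (AE x in lborel. p \<in> \<Omega> \<and> x \<in> \<Omega> \<longrightarrow> u x = u p)"
  proof (rule ccontr)
    assume no: "\<not> ?thesis"
    from 3 have "AE p in lborel. p \<notin> \<Omega>"
      by eventually_elim (use no in blast)
    with 4 show False ..
  qed
  then obtain p where "p \<in> \<Omega>" "AE x in lborel. p \<in> \<Omega> \<and> x \<in> \<Omega> \<longrightarrow> u x = u p" by blast
  then have "AE x in lborel. x \<in> \<Omega> \<longrightarrow> u x = u p" by simp
  then show ?thesis ..
qed

section \<open>Eigenfunctions with eigenvalue below 2j\<close>

lemma nn_integral_le_weighted:
  fixes f \<sigma> :: "'a::euclidean_space \<Rightarrow> real"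
  assumes \<Omega>: "open \<Omega>" and \<sigma>[measurable]: "\<sigma> \<in> borel_measurable borel"
    and c: "c > 0" "\<And>x. x \<in> \<Omega> \<Longrightarrow> c \<le> \<sigma> x"
    and f: "integrable (weighted_measure \<Omega> \<sigma>) f" "\<And>x. f x \<ge> 0"
  shows "(\<integral>\<^sup>+x\<in>\<Omega>. ennreal (f x) \<partial>lborel) \<le> ennreal ((\<integral>x. f x \<partial>weighted_measure \<Omega> \<sigma>) / c)"
proof -
  have [measurable]: "\<Omega> \<in> sets borel" using \<Omega>(1) by simp
  have [measurable]: "f \<in> borel_measurable borel"
    using borel_measurable_integrable[OF f(1)] unfolding weighted_measure_def by simp
  have "(\<integral>\<^sup>+x\<in>\<Omega>. ennreal (f x) \<partial>lborel) \<le> (\<integral>\<^sup>+x. ennreal (1 / c) * (ennreal (indicator \<Omega> x * \<sigma> x) * ennreal (f x)) \<partial>lborel)"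
  proof (intro nn_integral_mono)
    fix x
    show "ennreal (f x) * indicator \<Omega> x \<le> ennreal (1 / c) * (ennreal (indicator \<Omega> x * \<sigma> x) * ennreal (f x))"
    proof (cases "x \<in> \<Omega>")
      case True
      have "f x * 1 \<le> f x * (\<sigma> x / c)" using c c(2)[OF True] f(2) by (intro mult_left_mono) auto
      then have "ennreal (f x) \<le> ennreal (1 / c * (\<sigma> x * f x))" by (intro ennreal_leI) (simp add: mult.commute)
      also have "\<dots> = ennreal (1 / c) * (ennreal (\<sigma> x) * ennreal (f x))"
      proof -
        have "0 \<le> 1 / c" "0 \<le> \<sigma> x" using c(1) c(2)[OF True] by simp_all
        then show ?thesis using f(2)[of x] by (simp only: ennreal_mult mult_nonneg_nonneg)
      qed
      finally show ?thesis using True by simp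
    qed simp
  qed
  also have "\<dots> = ennreal (1 / c) * (\<integral>\<^sup>+x. ennreal (f x) \<partial>weighted_measure \<Omega> \<sigma>)"
    unfolding weighted_measure_def by (simp add: nn_integral_density nn_integral_cmult)
  also have "(\<integral>\<^sup>+x. ennreal (f x) \<partial>weighted_measure \<Omega> \<sigma>) = ennreal (\<integral>x. f x \<partial>weighted_measure \<Omega> \<sigma>)"
    by (rule nn_integral_eq_integral[OF f(1)]) (simp add: f(2))
  also have "ennreal (1 / c) * \<dots> = ennreal ((\<integral>x. f x \<partial>weighted_measure \<Omega> \<sigma>) / c)"
    using c f(2) by (simp add: ennreal_mult[symmetric])
  finally show ?thesis .
qed

text \<open>With N > 0 the squared norm of u, the energies tend to \<open>\<mu> * N\<close> and the
  squared norms of L v to \<open>\<mu> * (\<mu> * N)\<close>. Hence \<open>\<mu> \<ge> 0\<close> and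
  \<open>(2 * j - \<mu>) * \<mu> \<le> 0\<close>, which forces \<open>\<mu> = 0\<close>; the
  gradients then tend to 0 in L2.\<close>

lemma neumann_eigenfunction_below_gap_constant:
  fixes \<Omega> :: "(real^'n) set" and j :: real
  assumes \<Omega>: "open \<Omega>" "\<Omega> \<noteq> {}" "bounded \<Omega>" "convex \<Omega>" "smooth_boundary \<Omega>" and j: "j > 0"
    and \<sigma>_def: "\<sigma> = (\<lambda>x. exp (- j * (norm x)\<^sup>2))"
    and u: "neumann_eigenfunction \<Omega> \<sigma> \<mu> u" and \<mu>: "\<mu> < 2 * j"
  shows "\<exists>c. AE x in weighted_measure \<Omega> \<sigma>. u x = c"
proof -
  let ?M = "weighted_measure \<Omega> \<sigma>" and ?L = "weighted_laplacian \<sigma>"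
  have \<sigma>: "smooth \<sigma>" unfolding \<sigma>_def by (rule smooth_gaussian)
  have \<sigma>m[measurable]: "\<sigma> \<in> borel_measurable borel"
    by (intro borel_measurable_continuous_onI smooth_continuous \<sigma>)
  have \<sigma>0: "\<sigma> x \<ge> 0" for x by (simp add: \<sigma>_def)
  obtain v where v: "\<And>m. smooth (v m)" "\<And>m. neumann_condition \<Omega> (v m)"
    and vu: "L2_tendsto ?M v u" and Lvu: "L2_tendsto ?M (\<lambda>m. ?L (v m)) (\<lambda>x. \<mu> * u x)"
    and nz: "\<not> (AE x in ?M. u x = 0)"
    using u unfolding neumann_eigenfunction_def neumann_operator_def by blast
  have L: "v m \<in> L2 ?M" "u \<in> L2 ?M" for m
    using vu unfolding L2_tendsto_def by auto
  have meas: "f \<in> borel_measurable borel" if "smooth f" for f :: "real^'n \<Rightarrow> real"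
    by (intro borel_measurable_continuous_onI smooth_continuous that)
  have Lv: "smooth (?L (v m))" for m
    unfolding \<sigma>_def by (rule smooth_weighted_laplacian_gaussian[OF v(1)])
  have energy: "(\<integral>x. (norm (grad (v m) x))\<^sup>2 \<partial>?M) = (\<integral>x. v m x * ?L (v m) x \<partial>?M)" for m
    using neumann_energy[OF \<Omega> v \<sigma>_def, of m]
    by (simp add: integral_weighted_measure[OF \<Omega>(1) \<sigma>m \<sigma>0 meas] smooth_norm_grad_square v(1) Lv smooth_mult)
  have bochner: "2 * j * (\<integral>x. (norm (grad (v m) x))\<^sup>2 \<partial>?M) \<le> (\<integral>x. ?L (v m) x * ?L (v m) x \<partial>?M)" for m
    using neumann_bochner[OF \<Omega> v \<sigma>_def, of m]
    by (simp add: integral_weighted_measure[OF \<Omega>(1) \<sigma>m \<sigma>0 meas] smooth_norm_grad_square v(1) Lv smooth_mult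
        smooth_power2 flip: power2_eq_square)
  define N where "N = (\<integral>x. (u x)\<^sup>2 \<partial>?M)"
  have "N \<noteq> 0"
    unfolding N_def using nz integral_nonneg_eq_0_iff_AE[OF L2D(2)[OF L(2)]] by simp
  moreover have "N \<ge> 0" by (simp add: N_def)
  ultimately have N: "N > 0" by simp
  have int_uu: "(\<integral>x. u x * (\<mu> * u x) \<partial>?M) = \<mu> * N" "(\<integral>x. (\<mu> * u x) * (\<mu> * u x) \<partial>?M) = \<mu> * (\<mu> * N)"
    unfolding N_def by (simp_all add: mult.assoc mult.left_commute power2_eq_square)
  have lim: "(\<lambda>m. \<integral>x. (norm (grad (v m) x))\<^sup>2 \<partial>?M) \<longlonglongrightarrow> \<mu> * N"
    unfolding energy using L2_tendsto_mult[OF vu Lvu] by (simp only: int_uu)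
  have lim2: "(\<lambda>m. \<integral>x. ?L (v m) x * ?L (v m) x \<partial>?M) \<longlonglongrightarrow> \<mu> * (\<mu> * N)"
    using L2_tendsto_mult[OF Lvu Lvu] by (simp only: int_uu)
  have "0 \<le> \<mu> * N" by (rule LIMSEQ_le_const[OF lim]) simp
  then have "0 \<le> \<mu>" using N by (simp add: zero_le_mult_iff)
  moreover have "2 * j * (\<mu> * N) \<le> \<mu> * (\<mu> * N)"
    by (rule LIMSEQ_le[OF tendsto_mult_left[OF lim] lim2]) (use bochner in blast)
  then have "(2 * j - \<mu>) * (\<mu> * N) \<le> 0" by (simp add: algebra_simps)
  then have "\<mu> * N \<le> 0" using \<mu> by (simp add: mult_le_0_iff)
  then have "\<mu> \<le> 0" using N by (simp add: mult_le_0_iff)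
  ultimately have "\<mu> = 0" by simp
  obtain R where R: "\<And>x. x \<in> \<Omega> \<Longrightarrow> norm x \<le> R" using \<Omega>(3) unfolding bounded_iff by blast
  \<comment> \<open>A positive lower bound of the weight on the bounded domain, which converts
    weighted estimates into estimates in Lebesgue measure.\<close>
  define c where "c = exp (- j * R\<^sup>2)"
  have c: "c > 0" "\<And>x. x \<in> \<Omega> \<Longrightarrow> c \<le> \<sigma> x"
    using j R by (auto simp: c_def \<sigma>_def power_mono)
  have um: "u \<in> borel_measurable borel" using L2D(1)[OF L(2)] unfolding weighted_measure_def by simp
  have grad_int: "integrable ?M (\<lambda>x. (norm (grad (v m) x))\<^sup>2)" for m
  proof -
    have "set_integrable lborel \<Omega> (\<lambda>x. \<sigma> x * (norm (grad (v m) x))\<^sup>2)"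
      by (intro set_integrable_continuous_bounded \<Omega> smooth_continuous smooth_mult \<sigma> smooth_norm_grad_square v)
    then show ?thesis
      unfolding weighted_measure_def set_integrable_def
      using \<Omega>(1) \<sigma>0 meas[OF smooth_norm_grad_square[OF v(1)]]
      by (subst integrable_density) (auto simp: mult.assoc)
  qed
  have "\<exists>k. AE x in lborel. x \<in> \<Omega> \<longrightarrow> u x = k"
  proof (rule AE_constant_of_AE_midpoint[OF \<Omega>(1,2) um])
    fix p assume p: "p \<in> \<Omega>"
    show "AE x in lborel. x \<in> \<Omega> \<longrightarrow> u x = u (p + (1 / 2) *\<^sub>R (x - p))"
    proof (rule AE_eq_midpoint[OF \<Omega>(1,3,4) p um v(1)])
      show "(\<integral>\<^sup>+x\<in>\<Omega>. ennreal ((v m x - u x)\<^sup>2) \<partial>lborel) \<le> ennreal ((\<integral>x. (v m x - u x)\<^sup>2 \<partial>?M) / c)" for m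
        by (rule nn_integral_le_weighted[OF \<Omega>(1) \<sigma>m c L2D(2)[OF L2_diff[OF L]]]) auto
      show "(\<integral>\<^sup>+x\<in>\<Omega>. ennreal ((norm (grad (v m) x))\<^sup>2) \<partial>lborel) \<le> ennreal ((\<integral>x. (norm (grad (v m) x))\<^sup>2 \<partial>?M) / c)" for m
        by (rule nn_integral_le_weighted[OF \<Omega>(1) \<sigma>m c grad_int]) auto
      have "(\<lambda>m. \<integral>x. (v m x - u x)\<^sup>2 \<partial>?M) \<longlonglongrightarrow> 0" using vu unfolding L2_tendsto_def by blast
      then show "(\<lambda>m. (\<integral>x. (v m x - u x)\<^sup>2 \<partial>?M) / c) \<longlonglongrightarrow> 0" by (rule tendsto_divide_zero)
      show "(\<lambda>m. (\<integral>x. (norm (grad (v m) x))\<^sup>2 \<partial>?M) / c) \<longlonglongrightarrow> 0"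
        using lim unfolding \<open>\<mu> = 0\<close> by (intro tendsto_divide_zero) simp
    qed (use c(1) in auto)
  qed
  then obtain k where k: "AE x in lborel. x \<in> \<Omega> \<longrightarrow> u x = k" by blast
  have [measurable]: "\<Omega> \<in> sets borel" using \<Omega>(1) by simp
  have dens: "(\<lambda>x. ennreal (indicator \<Omega> x * \<sigma> x)) \<in> borel_measurable lborel" by measurable
  have "AE x in ?M. u x = k"
    unfolding weighted_measure_def AE_density[OF dens]
    using k by eventually_elim (auto simp: indicator_def)
  then show ?thesis by blast
qed

theorem proposition5p1:
  fixes \<Omega> :: "(real ^ 'n) set" and \<sigma> :: "real \<Rightarrow> real ^ 'n \<Rightarrow> real"
  assumes "open \<Omega>" and "\<Omega> \<noteq> {}" and "bounded \<Omega>" and "convex \<Omega>" and "smooth_boundary \<Omega>"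
    and "\<And>j x. j > 0 \<Longrightarrow> \<sigma> j x = exp (- j * (norm x)\<^sup>2)"
  shows "\<forall>j>0. neumann_eigenvalue \<Omega> (\<sigma> j) 2 \<ge> ereal (2 * j)"
proof (intro allI impI)
  fix j :: real assume j: "j > 0"
  have \<sigma>: "\<sigma> j = (\<lambda>x. exp (- j * (norm x)\<^sup>2))" using assms(6)[OF j] by blast
  let ?M = "weighted_measure \<Omega> (\<sigma> j)"
  \<comment> \<open>Were t < 2j, both eigenfunctions would be constant almost everywhere, and two
    constants are linearly dependent.\<close>
  have "2 * j \<le> t" if eig: "\<forall>i<2. neumann_eigenfunction \<Omega> (\<sigma> j) (\<mu> i) (u i) \<and> \<mu> i \<le> t"
    and indep: "L2_independent ?M 2 u" for t \<mu> u
  proof (rule ccontr)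
    assume "\<not> 2 * j \<le> t"
    then have "\<exists>c. AE x in ?M. u i x = c" if "i < 2" for i
      using that eig neumann_eigenfunction_below_gap_constant[OF assms(1-5) j \<sigma>, of "\<mu> i" "u i"] by force
    from this[of 0] this[of 1] obtain c0 c1 where
      c: "AE x in ?M. u 0 x = c0" "AE x in ?M. u 1 x = c1" by auto
    \<comment> \<open>The relation c1 u0 - c0 u1 = 0. Independence then gives c0 = 0, so the
      eigenfunction u0 would vanish almost everywhere.\<close>
    let ?c = "\<lambda>i::nat. if i = 0 then c1 else - c0"
    have "AE x in ?M. (\<Sum>i<2. ?c i * u i x) = 0"
      using c by eventually_elim (simp add: numeral_2_eq_2)
    then have "\<forall>i<2. ?c i = 0" by (rule mp[OF spec[OF indep[unfolded L2_independent_def], of ?c]])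
    then have "c0 = 0" by (auto dest: spec[of _ 1])
    then show False using c(1) eig unfolding neumann_eigenfunction_def by auto
  qed
  \<comment> \<open>The infimum of the empty set is infinity, so this also covers the case of fewer
    than two eigenvalues.\<close>
  then show "ereal (2 * j) \<le> neumann_eigenvalue \<Omega> (\<sigma> j) 2"
    unfolding neumann_eigenvalue_def by (intro Inf_greatest) auto
qed

end
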